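(* Let $m,n\in\mathbb N$ with $m\equiv n\pmod 2$, and let $\sigma\in\mathcal B_{nm}$ with $r=\operatorname{rank}(\sigma)$. The number of idempotents of the sandwich semigroup $\mathcal B_{mn}^\sigma$ is $$e(\mathcal B_{mn}^\sigma)=\sum_{\substack{0\leq q\leq r\\ q\equiv r\ (\mathrm{mod}\ 2)}}\binom rq\frac{(r-q-1)!!\,(m+q-1)!!\,(n+q-1)!!}{(r+q-1)!!\,(2q-1)!!}.$$ The $q$th term in this sum gives the number of idempotents of $\mathcal B_{mn}^\sigma$ contained in $D_q^\sigma=\{\alpha\in\operatorname{Reg}(\mathcal B_{mn}^\sigma):\operatorname{rank}(\alpha)=q\}$.
   Context: $\mathbb N=\{0,1,2,\ldots\}$, $[n]=\{1,\ldots,n\}$ (with $[0]=\emptyset$), and $A'=\{a':a\in A\}$, $A''=\{a'':a\in A\}$ for $A\subseteq\mathbb N$. For $m,n\in\mathbb N$, $\mathcal B_{mn}$ is the set of all Brauer partitions, i.e. set partitions of $[m]\cup[n]'$ into blocks of size $2$. For $\alpha\in\mathcal B_{mn}$ and $\beta\in\mathcal B_{nk}$, the product $\alpha\beta\in\mathcal B_{mk}$ is formed as follows: view partitions as graphs whose connected components are the blocks; let $\alpha_\downarrow$ be the graph on $[m]\cup[n]''$ obtained from $\alpha$ by renaming each $x'$ to $x''$, let $\beta^\uparrow$ be the graph on $[n]''\cup[k]'$ obtained from $\beta$ by renaming each $x\in[n]$ to $x''$, and let $\Pi(\alpha,\beta)$ be the union of these graphs on $[m]\cup[n]''\cup[k]'$;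 two elements of $[m]\cup[k]'$ lie in the same block of $\alpha\beta$ iff they lie in the same connected component of $\Pi(\alpha,\beta)$. The rank of $\alpha\in\mathcal B_{mn}$ is the number of blocks of $\alpha$ meeting both $[m]$ and $[n]'$. For $\sigma\in\mathcal B_{nm}$, the sandwich semigroup $\mathcal B_{mn}^\sigma$ is the set $\mathcal B_{mn}$ with the associative operation $\alpha\star_\sigma\beta=\alpha\sigma\beta$. $\operatorname{Reg}(T)$ denotes the set of (von Neumann) regular elements of a semigroup $T$. For odd $k\ge1$, $k!!=k(k-2)\cdots3\cdot1$, and $(-1)!!=1$. *)

theory Defs
  imports Complex_Main "HOL-Library.Disjoint_Sets" "HOL-Number_Theory.Cong"
begin

text \<open>Vertices: \<open>Unprimed i\<close>, \<open>Primed i\<close>, \<open>DPrimed i\<close> stand for \<open>i\<close>, \<open>i'\<close>, \<open>i''\<close>.\<close>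

datatype vertex = Unprimed nat | Primed nat | DPrimed nat

definition vertices :: "nat \<Rightarrow> nat \<Rightarrow> vertex set" where
  "vertices m n = Unprimed ` {1..m} \<union> Primed ` {1..n}"

definition brauer :: "nat \<Rightarrow> nat \<Rightarrow> vertex set set set" where
  "brauer m n = {\<alpha>. partition_on (vertices m n) \<alpha> \<and> (\<forall>B\<in>\<alpha>. card B = 2)}"

definition brauer_rank :: "vertex set set \<Rightarrow> nat" where
  "brauer_rank \<alpha> =
     card {B \<in> \<alpha>. B \<inter> range Unprimed \<noteq> {} \<and> B \<inter> range Primed \<noteq> {}}"

fun lower :: "vertex \<Rightarrow> vertex" where
  "lower (Primed i) = DPrimed i"
| "lower x = x"

fun raise :: "vertex \<Rightarrow> vertex" where
  "raise (Unprimed i) = DPrimed i"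
| "raise x = x"

text \<open>
  The adjacency relation of the graph in which each block of a partition is a complete graph
  (with loops), so that the connected components are the blocks.
\<close>

definition block_edges :: "vertex set set \<Rightarrow> (vertex \<times> vertex) set" where
  "block_edges \<alpha> = (\<Union>B\<in>\<alpha>. B \<times> B)"

definition product_graph :: "vertex set set \<Rightarrow> vertex set set \<Rightarrow> (vertex \<times> vertex) set" where
  "product_graph \<alpha> \<beta> =
     block_edges ((`) lower ` \<alpha>) \<union> block_edges ((`) raise ` \<beta>)"

text \<open>
  For \<open>\<alpha> \<in> brauer m n\<close> and \<open>\<beta> \<in> brauer n k\<close>, \<open>brauer_prod m k \<alpha> \<beta>\<close> is the product \<open>\<alpha>\<beta>\<close>;
  the middle index \<open>n\<close> is not needed. The graph is symmetric, so its reflexive-transitive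
  closure is the relation of lying in the same connected component.
\<close>

definition brauer_prod ::
    "nat \<Rightarrow> nat \<Rightarrow> vertex set set \<Rightarrow> vertex set set \<Rightarrow> vertex set set" where
  "brauer_prod m k \<alpha> \<beta> =
     vertices m k // {(x, y). x \<in> vertices m k \<and> y \<in> vertices m k \<and>
                              (x, y) \<in> (product_graph \<alpha> \<beta>)\<^sup>*}"

text \<open>The operation of the sandwich semigroup on \<open>brauer m n\<close>, where \<open>\<sigma> \<in> brauer n m\<close>.\<close>

definition sandwich ::
    "nat \<Rightarrow> nat \<Rightarrow> vertex set set \<Rightarrow> vertex set set \<Rightarrow> vertex set set \<Rightarrow> vertex set set" where
  "sandwich m n \<sigma> \<alpha> \<beta> = brauer_prod m n (brauer_prod m m \<alpha> \<sigma>) \<beta>"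

definition idempotents :: "'a set \<Rightarrow> ('a \<Rightarrow> 'a \<Rightarrow> 'a) \<Rightarrow> 'a set" where
  "idempotents T f = {x \<in> T. f x x = x}"

definition regulars :: "'a set \<Rightarrow> ('a \<Rightarrow> 'a \<Rightarrow> 'a) \<Rightarrow> 'a set" where
  "regulars T f = {x \<in> T. \<exists>y\<in>T. f (f x y) x = x}"

definition D_set :: "nat \<Rightarrow> nat \<Rightarrow> vertex set set \<Rightarrow> nat \<Rightarrow> vertex set set set" where
  "D_set m n \<sigma> q =
     {\<alpha> \<in> regulars (brauer m n) (sandwich m n \<sigma>). brauer_rank \<alpha> = q}"

text \<open>
  The double factorial of an odd integer \<open>k \<ge> -1\<close>; the empty product gives the value \<open>1\<close> at \<open>-1\<close>.
  It is not meant for even arguments.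
\<close>

definition odd_dfact :: "int \<Rightarrow> int" where
  "odd_dfact k = (\<Prod>i\<in>{i\<in>{1..k}. odd i}. i)"

end

theory Submission
  imports Defs
begin

text \<open>
  Glue \<open>\<alpha>\<close> and \<open>\<sigma>\<close> along both rows, that is, read both as perfect matchings of the single set
  \<open>[m] \<union> [n]'\<close>. Their union is a disjoint union of cycles, and the whole proof rests on the
  criterion \<open>sandwich_idempotent_iff\<close>: \<open>\<alpha>\<close> is an idempotent of the sandwich semigroup iff each of
  these cycles contains at most one transversal of \<open>\<alpha>\<close>. Indeed, \<open>\<alpha>\<sigma>\<alpha> = \<alpha>\<close> says that for every
  transversal \<open>{x, y'}\<close> of \<open>\<alpha>\<close>, the vertex \<open>y\<close> on the lower row of the first copy of \<open>\<alpha>\<close> is linked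
  to the vertex \<open>x\<close> on the upper row of the second copy by edges of \<open>\<sigma>\<close> and non-transversal edges
  of \<open>\<alpha>\<close> only; together with the transversal itself, such a link makes up a
  cycle of the glued graph that contains no other transversal of \<open>\<alpha>\<close>.

  Let \<open>F\<close> be the number of matchings \<open>\<alpha>\<close> of a set \<open>M = X \<union> Y\<close> that have \<open>q\<close> edges between \<open>X\<close>
  and \<open>Y\<close> and satisfy this cycle condition for a given \<open>\<sigma>\<close> with \<open>r\<close> edges between \<open>X\<close> and \<open>Y\<close>. It is
  computed by contracting edges.
  \<^item> Suppose that \<open>\<sigma>\<close> has an edge \<open>{a, b}\<close> inside \<open>Y\<close>. Removing \<open>a\<close> and \<open>b\<close>, and joining their
    \<open>\<alpha>\<close>-neighbours if \<open>{a, b}\<close> is not an edge of \<open>\<alpha>\<close>, is a \<open>(card Y + q - 1)\<close>-to-one map onto the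
    matchings counted for the smaller set (\<open>card_sep_matchings_remove_edge\<close>). By symmetry
    (\<open>sep_matchings_flip\<close>) the same holds for \<open>X\<close>.
  \<^item> When \<open>\<sigma>\<close> has no edges inside \<open>Y\<close>, so that \<open>card Y = r\<close>, double counting the pairs of such an
    \<open>\<alpha>\<close> and an ordered edge of \<open>\<alpha>\<close> inside \<open>Y\<close> gives \<open>(r - q) F = r (r - 1) F'\<close>, where \<open>F'\<close> counts
    for \<open>r - 2\<close> in place of \<open>r\<close> (\<open>card_sep_matchings_no_outer_edges\<close>).
  \<^item> When \<open>card Y = q\<close> and \<open>\<sigma>\<close> has no edges inside \<open>Y\<close>, the edges of \<open>\<sigma>\<close> inside \<open>X\<close> are
    contracted as in the first step, until all edges run between \<open>X\<close> and \<open>Y\<close> and only \<open>\<alpha> = \<sigma>\<close>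
    remains (\<open>card_sep_matchings_all_crossing\<close>).
  Multiplying the factors gives \<open>card_sep_matchings\<close>, which is the \<open>q\<close>th term of the sum.
\<close>

section \<open>Matchings as involutions, and edge contraction\<close>

text \<open>A perfect matching of \<open>M\<close>, encoded as the involution that maps each vertex to its partner and
  fixes everything outside \<open>M\<close>.\<close>

definition matchings :: "'a set \<Rightarrow> ('a \<Rightarrow> 'a) set" where
  "matchings M = {f. (\<forall>x. f (f x) = x) \<and> (\<forall>x. f x \<noteq> x \<longleftrightarrow> x \<in> M)}"

text \<open>Lying in the same connected component of the union of the matchings \<open>f\<close> and \<open>g\<close>. The steps
  are directed, but they can be reversed because \<open>f\<close> and \<open>g\<close> are involutions.\<close>

definition joined :: "('a \<Rightarrow> 'a) \<Rightarrow> ('a \<Rightarrow> 'a) \<Rightarrow> ('a \<times> 'a) set" where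
  "joined f g = {(x, y). y = f x \<or> y = g x}\<^sup>*"

text \<open>A set \<open>A\<close> splits the vertices into two colour classes \<open>A\<close> and \<open>- A\<close>. An edge of \<open>f\<close> that joins
  the classes is represented by its end in \<open>A\<close>, so that the set is not affected when an edge
  of \<open>f\<close> inside \<open>- A\<close> is removed.\<close>

definition crossing :: "'a set \<Rightarrow> ('a \<Rightarrow> 'a) \<Rightarrow> 'a set" where
  "crossing A f = {x \<in> A. f x \<notin> A}"

text \<open>No component of the union of \<open>f\<close> and \<open>g\<close> contains two edges of \<open>f\<close> that join the classes; edges
  of \<open>g\<close> are not restricted.\<close>

definition separated :: "'a set \<Rightarrow> ('a \<Rightarrow> 'a) \<Rightarrow> ('a \<Rightarrow> 'a) \<Rightarrow> bool" where
  "separated A f g \<longleftrightarrow>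
     (\<forall>x\<in>crossing A f. \<forall>u\<in>crossing A f. (x, u) \<in> joined f g \<longrightarrow> x = u)"

text \<open>The matchings of \<open>M\<close> with \<open>q\<close> crossing edges that are separated with respect to \<open>g\<close>.\<close>

definition sep_matchings :: "'a set \<Rightarrow> 'a set \<Rightarrow> ('a \<Rightarrow> 'a) \<Rightarrow> nat \<Rightarrow> ('a \<Rightarrow> 'a) set" where
  "sep_matchings M A g q = {f \<in> matchings M. card (crossing A f) = q \<and> separated A f g}"

text \<open>Removal of the vertices \<open>a\<close> and \<open>b\<close>, whose partners become partners of each other. If \<open>{a, b}\<close> is
  an edge of \<open>f\<close>, that edge is deleted and nothing else changes. The last two updates take
  precedence, which makes one formula serve both cases.\<close>

definition contract :: "'a \<Rightarrow> 'a \<Rightarrow> ('a \<Rightarrow> 'a) \<Rightarrow> 'a \<Rightarrow> 'a" where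
  "contract a b f = f(f a := f b, f b := f a, a := a, b := b)"

text \<open>The matching whose contraction is \<open>h\<close> and in which \<open>a\<close> has the partner \<open>c\<close>: the edge
  \<open>{c, h c}\<close> of \<open>h\<close> is replaced by \<open>{a, c}\<close> and \<open>{b, h c}\<close>. Since \<open>h\<close> fixes \<open>b\<close>, the choice \<open>c = b\<close>
  adds the edge \<open>{a, b}\<close>.\<close>

definition expand :: "'a \<Rightarrow> 'a \<Rightarrow> 'a \<Rightarrow> ('a \<Rightarrow> 'a) \<Rightarrow> 'a \<Rightarrow> 'a" where
  "expand a b c h = h(h c := b, b := h c, c := a, a := c)"

lemma matchings_involution: "f \<in> matchings M \<Longrightarrow> f (f x) = x"
  by (simp add: matchings_def)

lemma matchings_moved: "f \<in> matchings M \<Longrightarrow> f x = x \<longleftrightarrow> x \<notin> M"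
  by (auto simp: matchings_def)

lemma matchings_in: "f \<in> matchings M \<Longrightarrow> f x \<in> M \<longleftrightarrow> x \<in> M"
  by (metis matchings_involution matchings_moved)

lemma finite_matchings:
  assumes "finite M" shows "finite (matchings M)"
proof (rule finite_subset)
  show "matchings M \<subseteq> {f. \<forall>x. (x \<in> M \<longrightarrow> f x \<in> M) \<and> (x \<notin> M \<longrightarrow> f x = x)}"
    using matchings_in matchings_moved by fastforce
  show "finite {f. \<forall>x. (x \<in> M \<longrightarrow> f x \<in> M) \<and> (x \<notin> M \<longrightarrow> f x = x)}"
  proof (rule finite_subset)
    let ?S = "{f. \<forall>x. (x \<in> M \<longrightarrow> f x \<in> M) \<and> (x \<notin> M \<longrightarrow> f x = undefined)}"
    show "finite ((\<lambda>h x. if x \<in> M then h x else x) ` ?S)"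
      by (intro finite_imageI finite_set_of_finite_funs assms)
    show "{f. \<forall>x. (x \<in> M \<longrightarrow> f x \<in> M) \<and> (x \<notin> M \<longrightarrow> f x = x)}
        \<subseteq> (\<lambda>h x. if x \<in> M then h x else x) ` ?S"
    proof
      fix f assume f: "f \<in> {f. \<forall>x. (x \<in> M \<longrightarrow> f x \<in> M) \<and> (x \<notin> M \<longrightarrow> f x = x)}"
      then show "f \<in> (\<lambda>h x. if x \<in> M then h x else x) ` ?S"
        by (intro image_eqI[where x = "\<lambda>x. if x \<in> M then f x else undefined"]) auto
    qed
  qed
qed

lemma finite_sep_matchings: "finite M \<Longrightarrow> finite (sep_matchings M A g q)"
  by (simp add: sep_matchings_def finite_matchings)

lemma joined_refl [simp]: "(x, x) \<in> joined f g"
  by (simp add: joined_def)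

lemma joined_trans: "(x, y) \<in> joined f g \<Longrightarrow> (y, z) \<in> joined f g \<Longrightarrow> (x, z) \<in> joined f g"
  by (simp add: joined_def)

lemma joined_step1: "(x, f x) \<in> joined f g" and joined_step2: "(x, g x) \<in> joined f g"
  by (auto simp: joined_def)

lemma joined_commute: "joined f g = joined g f"
  by (simp add: joined_def disj_commute)

lemma joined_invariant [consumes 1]:
  assumes "(x, y) \<in> joined f g" "S x" "\<And>v. S v \<Longrightarrow> S (f v)" "\<And>v. S v \<Longrightarrow> S (g v)"
  shows "S y"
  using assms(1) unfolding joined_def by (induction rule: rtrancl_induct) (use assms in auto)

lemma joined_sym:
  assumes "\<And>x. f (f x) = x" "\<And>x. g (g x) = x" "(x, y) \<in> joined f g"
  shows "(y, x) \<in> joined f g"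
  using assms(3)
proof (rule joined_invariant)
  show "(v, x) \<in> joined f g \<Longrightarrow> (f v, x) \<in> joined f g" for v
    using joined_step1[of "f v" f g] assms(1) joined_trans by metis
  show "(v, x) \<in> joined f g \<Longrightarrow> (g v, x) \<in> joined f g" for v
    using joined_step2[of "g v" g f] assms(2) joined_trans by metis
qed simp

lemma contract_in_matchings:
  assumes "f \<in> matchings M" "a \<in> M" "b \<in> M" "a \<noteq> b"
  shows "contract a b f \<in> matchings (M - {a, b})"
proof -
  note i = matchings_involution[OF assms(1)] and m = matchings_moved[OF assms(1)]
  have inj: "f x = f y \<longleftrightarrow> x = y" for x y by (metis i)
  have "contract a b f (contract a b f x) = x" for x
    unfolding contract_def using i inj m assms by auto
  moreover have "contract a b f x \<noteq> x \<longleftrightarrow> x \<in> M - {a, b}" for x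
    unfolding contract_def using i inj m assms by auto
  ultimately show ?thesis by (simp add: matchings_def)
qed

lemma contract_edge: "g a = b \<Longrightarrow> g b = a \<Longrightarrow> contract a b g = g(a := a, b := b)"
  by (auto simp: contract_def)

text \<open>Contracting an edge \<open>{a, b}\<close> of one of the two matchings does not change which of the remaining
  vertices lie in the same component.\<close>

lemma joined_contract:
  assumes f: "f \<in> matchings M" and g: "g \<in> matchings M" and "a \<in> M" and ab: "g a = b"
    and x: "x \<notin> {a, b}" and u: "u \<notin> {a, b}"
  shows "(x, u) \<in> joined (contract a b f) (contract a b g) \<longleftrightarrow> (x, u) \<in> joined f g"
proof
  note fi = matchings_involution[OF f]
  note gi = matchings_involution[OF g]
  have ba: "g b = a" using ab gi by auto
  have neq: "a \<noteq> b" using ab \<open>a \<in> M\<close> matchings_moved[OF g] by metis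
  have bM: "b \<in> M" using ab \<open>a \<in> M\<close> matchings_in[OF g] by metis
  have inj: "f x = f y \<longleftrightarrow> x = y" for x y by (metis fi)
  have cg: "contract a b g = g(a := a, b := b)" using ab ba by (rule contract_edge)
  {
    assume "(x, u) \<in> joined (contract a b f) (contract a b g)"
    then show "(x, u) \<in> joined f g"
    proof (rule joined_invariant)
      have cd: "(f a, f b) \<in> joined f g"
        using joined_step1[of "f a" f g] joined_step2[of a g f] joined_step1[of b f g] ab fi
        by (metis joined_trans)
      have dc: "(f b, f a) \<in> joined f g"
        by (rule joined_sym[OF _ _ cd]) (use fi gi in auto)
      show "(x, contract a b f v) \<in> joined f g" if "(x, v) \<in> joined f g" for v
        using that cd dc joined_step1[of v f g] fi unfolding contract_def
        by (auto intro: joined_trans)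
      show "(x, contract a b g v) \<in> joined f g" if "(x, v) \<in> joined f g" for v
        using that joined_step2[of v g f] unfolding cg by (auto intro: joined_trans)
    qed simp
  }
  {
    let ?J = "joined (contract a b f) (contract a b g)"
    \<comment> \<open>\<open>\<rho>\<close> retracts the graph onto the contracted one: \<open>a\<close> and \<open>b\<close> move to their \<open>f\<close>-partners, unless
      they form a component of their own, which is collapsed to \<open>a\<close>.\<close>
    define \<rho> where "\<rho> v = (if f a = b then (if v = b then a else v)
      else if v = a then f a else if v = b then f b else v)" for v
    assume "(x, u) \<in> joined f g"
    then have "(x, \<rho> u) \<in> ?J"
    proof (rule joined_invariant)
      show "(x, \<rho> x) \<in> ?J" using x by (simp add: \<rho>_def)
      show "(x, \<rho> (f v)) \<in> ?J" if "(x, \<rho> v) \<in> ?J" for v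
      proof -
        have "(\<rho> v, \<rho> (f v)) \<in> ?J"
        proof (cases "v \<in> {a, b} \<or> f v \<in> {a, b}")
          case True
          then have "\<rho> v = \<rho> (f v)" using fi inj neq unfolding \<rho>_def by auto
          then show ?thesis by simp
        next
          case False
          then have "v \<noteq> f a" "v \<noteq> f b" using fi by auto
          then have "\<rho> v = v" "\<rho> (f v) = f v" "contract a b f v = f v"
            using False by (auto simp: \<rho>_def contract_def)
          then show ?thesis using joined_step1[of v "contract a b f"] by metis
        qed
        with that show ?thesis by (rule joined_trans)
      qed
      show "(x, \<rho> (g v)) \<in> ?J" if "(x, \<rho> v) \<in> ?J" for v
      proof -
        have "(\<rho> v, \<rho> (g v)) \<in> ?J"
        proof (cases "v \<in> {a, b}")
          case True
          have "(f a, f b) \<in> ?J" "(f b, f a) \<in> ?J" if "f a \<noteq> b"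
          proof -
            have "f b \<noteq> a" using that fi by metis
            moreover have "f a \<noteq> a" "f b \<noteq> b"
              using matchings_moved[OF f] \<open>a \<in> M\<close> bM by auto
            moreover have "f a \<noteq> f b" using neq inj by simp
            ultimately have "contract a b f (f a) = f b" "contract a b f (f b) = f a"
              using that by (auto simp: contract_def)
            then show "(f a, f b) \<in> ?J" "(f b, f a) \<in> ?J" using joined_step1 by metis+
          qed
          then show ?thesis using True ab ba neq by (auto simp: \<rho>_def)
        next
          case False
          then have "g v \<notin> {a, b}" using gi ab ba by (metis insert_iff singletonD)
          then have "\<rho> v = v" "\<rho> (g v) = g v" "contract a b g v = g v"
            using False by (auto simp: \<rho>_def cg)
          then show ?thesis using joined_step2[of v "contract a b g"] by metis
        qed
        with that show ?thesis by (rule joined_trans)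
      qed
    qed
    moreover have "\<rho> u = u" using u by (auto simp: \<rho>_def)
    ultimately show "(x, u) \<in> ?J" by simp
  }
qed

lemma crossing_contract:
  assumes f: "f \<in> matchings M" and "a \<notin> A" "b \<notin> A" "f a \<notin> A \<or> f b \<notin> A"
  shows "crossing A (contract a b f) = crossing A f"
  using assms matchings_involution[OF f] unfolding crossing_def contract_def by auto

lemma separated_contract:
  assumes f: "f \<in> matchings M" and g: "g \<in> matchings M" and "a \<in> M" "g a = b"
    and "a \<notin> A" "b \<notin> A" "crossing A (contract a b f) = crossing A f"
  shows "separated A (contract a b f) (contract a b g) \<longleftrightarrow> separated A f g"
proof -
  have "x \<notin> {a, b}" if "x \<in> crossing A f" for x using that assms by (auto simp: crossing_def)
  then show ?thesis
    unfolding separated_def using joined_contract[OF f g \<open>a \<in> M\<close> \<open>g a = b\<close>] assms by simp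
qed

text \<open>If the partners of both \<open>a\<close> and \<open>b\<close> were in \<open>A\<close>, the component of \<open>a\<close> and \<open>b\<close> would contain two
  crossing edges. This is the only way in which contracting two vertices outside \<open>A\<close> could
  change the set of crossing edges of \<open>f\<close>.\<close>

lemma separated_not_both:
  assumes f: "f \<in> matchings M" and "separated A f g" "g a = b" "a \<noteq> b" "a \<notin> A" "b \<notin> A"
  shows "f a \<notin> A \<or> f b \<notin> A"
proof (rule ccontr)
  note fi = matchings_involution[OF f]
  assume "\<not> ?thesis"
  then have "f a \<in> crossing A f" "f b \<in> crossing A f" using assms fi by (auto simp: crossing_def)
  moreover have "(f a, f b) \<in> joined f g"
    using joined_step1[of "f a" f g] joined_step2[of a g f] joined_step1[of b f g] assms fi
    by (metis joined_trans)
  ultimately have "f a = f b" using assms by (auto simp: separated_def)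
  then show False using fi \<open>a \<noteq> b\<close> by metis
qed

lemma expand_contract:
  assumes "f \<in> matchings M" "a \<in> M" "b \<in> M" "a \<noteq> b"
  shows "expand a b (f a) (contract a b f) = f"
proof
  note i = matchings_involution[OF assms(1)] and m = matchings_moved[OF assms(1)]
  have inj: "f x = f y \<longleftrightarrow> x = y" for x y by (metis i)
  show "expand a b (f a) (contract a b f) x = f x" for x
    unfolding expand_def contract_def using i inj m assms by auto
qed

context
  fixes h :: "'a \<Rightarrow> 'a" and M a b c
  assumes h: "h \<in> matchings (M - {a, b})" and a: "a \<in> M" and b: "b \<in> M" and ab: "a \<noteq> b"
    and c: "c \<in> insert b (M - {a, b})"
begin

lemma expand_in_matchings: "expand a b c h \<in> matchings M"
proof -
  note i = matchings_involution[OF h] and m = matchings_moved[OF h]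
  have inj: "h x = h y \<longleftrightarrow> x = y" for x y by (metis i)
  have fixed: "h a = a" "h b = b" "h y = a \<longleftrightarrow> y = a" "h y = b \<longleftrightarrow> y = b" for y
    using m[of a] m[of b] inj[of y a] inj[of y b] by auto
  have "expand a b c h (expand a b c h x) = x" for x
    unfolding expand_def using i inj fixed m a b ab c by auto
  moreover have "expand a b c h x \<noteq> x \<longleftrightarrow> x \<in> M" for x
    unfolding expand_def using i inj fixed m[of x] m[of c] a b ab c by auto
  ultimately show ?thesis by (simp add: matchings_def)
qed

lemma contract_expand: "contract a b (expand a b c h) = h"
proof
  note i = matchings_involution[OF h] and m = matchings_moved[OF h]
  have inj: "h x = h y \<longleftrightarrow> x = y" for x y by (metis i)
  have fixed: "h a = a" "h b = b" "h y = a \<longleftrightarrow> y = a" "h y = b \<longleftrightarrow> y = b" for y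
    using m[of a] m[of b] inj[of y a] inj[of y b] by auto
  show "contract a b (expand a b c h) x = h x" for x
    unfolding contract_def expand_def using i inj m[of c] a b ab c by (auto simp: fixed)
qed

end

lemma expand_apply: "expand a b c h a = c"
  by (simp add: expand_def)

text \<open>The admissible positions at which an edge of \<open>h\<close> can be cut open: all vertices, except the ends of
  edges inside \<open>A\<close>.\<close>

lemma card_crossing_choices:
  assumes h: "h \<in> matchings M" and "finite M"
  shows "card {c \<in> M. c \<notin> A \<or> h c \<notin> A} = card (M - A) + card (crossing A h)"
proof -
  have sub: "crossing A h \<subseteq> M" using matchings_moved[OF h] by (force simp: crossing_def)
  then have "{c \<in> M. c \<notin> A \<or> h c \<notin> A} = (M - A) \<union> crossing A h"
    by (auto simp: crossing_def)
  moreover have "(M - A) \<inter> crossing A h = {}" by (auto simp: crossing_def)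
  ultimately show ?thesis using sub \<open>finite M\<close> by (simp add: card_Un_disjoint finite_subset)
qed

text \<open>The contraction step. A matching \<open>f\<close> is determined by its contraction \<open>h\<close> and the partner \<open>c\<close>
  of \<open>a\<close>, where \<open>c\<close> is \<open>b\<close> or one of the \<open>card (M - {a, b} - A) + q\<close> admissible positions in \<open>h\<close>.\<close>

lemma card_sep_matchings_remove_edge:
  assumes fin: "finite M" and g: "g \<in> matchings M" and a: "a \<in> M" and gab: "g a = b"
    and aA: "a \<notin> A" and bA: "b \<notin> A"
  shows "card (sep_matchings M A g q) =
    (card (M - A) + q - 1) * card (sep_matchings (M - {a, b}) A (contract a b g) q)"
proof -
  have b: "b \<in> M" using gab a matchings_in[OF g] by metis
  have ab: "a \<noteq> b" using gab a matchings_moved[OF g] by metis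
  let ?V = "sep_matchings M A g q" and ?V' = "sep_matchings (M - {a, b}) A (contract a b g) q"
  let ?C = "\<lambda>h. insert b {c \<in> M - {a, b}. c \<notin> A \<or> h c \<notin> A}"
  have "bij_betw (\<lambda>f. (contract a b f, f a)) ?V (SIGMA h:?V'. ?C h)"
  proof (rule bij_betw_byWitness[where f' = "\<lambda>(h, c). expand a b c h"])
    show "\<forall>f\<in>?V. (case (contract a b f, f a) of (h, c) \<Rightarrow> expand a b c h) = f"
      using a b ab by (auto simp: sep_matchings_def intro: expand_contract)
    show "\<forall>p\<in>SIGMA h:?V'. ?C h.
      (contract a b (case p of (h, c) \<Rightarrow> expand a b c h), (case p of (h, c) \<Rightarrow> expand a b c h) a) = p"
      using a b ab by (auto simp: sep_matchings_def expand_apply intro!: contract_expand)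
    show "(\<lambda>f. (contract a b f, f a)) ` ?V \<subseteq> (SIGMA h:?V'. ?C h)"
    proof (rule image_subsetI)
      fix f assume "f \<in> ?V"
      then have f: "f \<in> matchings M" and q: "card (crossing A f) = q" and s: "separated A f g"
        by (auto simp: sep_matchings_def)
      note fi = matchings_involution[OF f]
      have nb: "f a \<notin> A \<or> f b \<notin> A" using separated_not_both[OF f s gab ab aA bA] .
      have cr: "crossing A (contract a b f) = crossing A f"
        using crossing_contract[OF f aA bA nb] .
      have "contract a b f \<in> ?V'"
        using contract_in_matchings[OF f a b ab] separated_contract[OF f g a gab aA bA cr] q s cr
        by (simp add: sep_matchings_def)
      moreover have "f a \<in> ?C (contract a b f)"
      proof (cases "f a = b")
        case False
        have "f a \<in> M" "f a \<noteq> a" using a matchings_in[OF f] matchings_moved[OF f] by auto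
        moreover have "contract a b f (f a) = f b"
          using False \<open>f a \<noteq> a\<close> fi ab unfolding contract_def by auto
        ultimately show ?thesis using False nb by auto
      qed simp
      ultimately show "(contract a b f, f a) \<in> (SIGMA h:?V'. ?C h)" by simp
    qed
    show "(\<lambda>(h, c). expand a b c h) ` (SIGMA h:?V'. ?C h) \<subseteq> ?V"
    proof clarify
      fix h c assume hV: "h \<in> ?V'" and c: "c \<in> ?C h"
      let ?f = "expand a b c h"
      have h: "h \<in> matchings (M - {a, b})" using hV by (simp add: sep_matchings_def)
      have c': "c \<in> insert b (M - {a, b})" using c by auto
      have f: "?f \<in> matchings M" using expand_in_matchings[OF h a b ab c'] .
      have con: "contract a b ?f = h" using contract_expand[OF h a b ab c'] .
      have "h b = b" using matchings_moved[OF h] by simp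
      then have "?f a \<notin> A \<or> ?f b \<notin> A"
        using c bA ab aA by (auto simp: expand_def)
      then have cr: "crossing A h = crossing A ?f"
        using crossing_contract[OF f aA bA] con by simp
      then show "?f \<in> ?V"
        using separated_contract[OF f g a gab aA bA] f hV con by (simp add: sep_matchings_def)
    qed
  qed
  then have "card ?V = card (SIGMA h:?V'. ?C h)" by (rule bij_betw_same_card)
  also have "\<dots> = (\<Sum>h\<in>?V'. card (?C h))"
    using fin by (subst card_SigmaI) (auto intro: finite_sep_matchings)
  also have "\<dots> = (\<Sum>h\<in>?V'. card (M - A) + q - 1)"
  proof (rule sum.cong)
    fix h assume hV: "h \<in> ?V'"
    have "card (?C h) = Suc (card (M - {a, b} - A) + q)"
      using hV fin card_crossing_choices[of h "M - {a, b}" A]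
      by (simp add: sep_matchings_def)
    moreover have "M - A = insert a (insert b (M - {a, b} - A))" using a b aA bA by auto
    then have "card (M - A) = Suc (Suc (card (M - {a, b} - A)))" using fin ab by auto
    ultimately show "card (?C h) = card (M - A) + q - 1" by simp
  qed simp
  finally show ?thesis by simp
qed

section \<open>Counting separated matchings\<close>

text \<open>\<open>dfact_odd k\<close> is \<open>(2k - 1)!!\<close>.\<close>

definition dfact_odd :: "nat \<Rightarrow> nat" where
  "dfact_odd k = (\<Prod>i<k. 2 * i + 1)"

lemma dfact_odd_0 [simp]: "dfact_odd 0 = 1"
  and dfact_odd_Suc [simp]: "dfact_odd (Suc k) = (2 * k + 1) * dfact_odd k"
  by (simp_all add: dfact_odd_def)

lemma dfact_odd_pos: "dfact_odd k > 0"
  by (auto simp: dfact_odd_def intro: prod_pos)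

lemma card_Diff_pair:
  assumes "finite M" "a \<in> M" "b \<in> M" "a \<noteq> b"
  shows "card M = card (M - {a, b}) + 2"
  using assms card_Diff_subset[of "{a, b}" M] card_mono[of M "{a, b}"] by simp

lemma even_card_involution:
  assumes "finite C" "\<And>x. x \<in> C \<Longrightarrow> f x \<in> C \<and> f (f x) = x \<and> f x \<noteq> x"
  shows "even (card C)"
  using assms
proof (induction C rule: finite_psubset_induct)
  case (psubset C)
  show ?case
  proof (cases "C = {}")
    case False
    then obtain x where x: "x \<in> C" by auto
    let ?D = "C - {x, f x}"
    have fx: "f x \<in> C" "f (f x) = x" "f x \<noteq> x" using psubset.prems x by auto
    have "even (card ?D)"
    proof (rule psubset.IH)
      show "?D \<subset> C" using x by auto
      show "f y \<in> ?D \<and> f (f y) = y \<and> f y \<noteq> y" if "y \<in> ?D" for y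
        using that psubset.prems[of y] fx by (metis Diff_iff insert_iff singletonD)
    qed
    moreover have "card C = card ?D + 2" using card_Diff_pair[of C x "f x"] \<open>finite C\<close> x fx by simp
    ultimately show ?thesis by simp
  qed simp
qed

lemma crossing_subset: "f \<in> matchings M \<Longrightarrow> crossing A f \<subseteq> M \<inter> A"
  by (auto simp: crossing_def dest: matchings_moved) (metis matchings_moved)

lemma crossing_flip:
  assumes "f \<in> matchings M"
  shows "crossing (- A) f = f ` crossing A f"
proof (intro equalityI subsetI)
  note i = matchings_involution[OF assms]
  show "x \<in> f ` crossing A f" if "x \<in> crossing (- A) f" for x
    using that i by (intro image_eqI[of _ _ "f x"]) (auto simp: crossing_def)
  show "x \<in> crossing (- A) f" if "x \<in> f ` crossing A f" for x
    using that i by (auto simp: crossing_def)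
qed

lemma card_crossing_flip:
  assumes "f \<in> matchings M"
  shows "card (crossing (- A) f) = card (crossing A f)"
  unfolding crossing_flip[OF assms]
  by (intro card_image inj_onI) (metis matchings_involution[OF assms])

lemma even_card_outside:
  assumes f: "f \<in> matchings M" and fin: "finite M"
  shows "even (card (M - A) + card (crossing A f))"
proof -
  note i = matchings_involution[OF f]
  have sub: "crossing (- A) f \<subseteq> M - A" using crossing_subset[OF f, of "- A"] by auto
  have "even (card (M - A - crossing (- A) f))"
    by (rule even_card_involution[where f = f])
      (use fin i matchings_in[OF f] matchings_moved[OF f] in \<open>auto simp: crossing_def\<close>)
  moreover have "card (M - A) = card (M - A - crossing (- A) f) + card (crossing (- A) f)"
    using sub fin card_Diff_subset[OF _ sub] card_mono[OF _ sub] by (simp add: finite_subset)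
  ultimately show ?thesis using card_crossing_flip[OF f] by simp
qed

lemma even_card_matching:
  assumes f: "f \<in> matchings M" and fin: "finite M"
  shows "even (card M)"
  using even_card_outside[OF assms, of "{}"] by (simp add: crossing_def)

lemma separated_flip:
  assumes f: "f \<in> matchings M" and g: "g \<in> matchings M" and "separated A f g"
  shows "separated (- A) f g"
  unfolding separated_def
proof (intro ballI impI)
  note fi = matchings_involution[OF f] and gi = matchings_involution[OF g]
  fix x u assume x: "x \<in> crossing (- A) f" and u: "u \<in> crossing (- A) f" and xu: "(x, u) \<in> joined f g"
  have "(f x, f u) \<in> joined f g"
    using joined_step1[of "f x" f g] xu joined_step1[of u f g] fi by (metis joined_trans)
  moreover have "f x \<in> crossing A f" "f u \<in> crossing A f"
    using x u fi by (auto simp: crossing_def)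
  ultimately have "f x = f u" using assms(3) by (auto simp: separated_def)
  then show "x = u" by (metis fi)
qed

lemma sep_matchings_flip:
  assumes "g \<in> matchings M"
  shows "sep_matchings M (- A) g q = sep_matchings M A g q"
  using separated_flip[OF _ assms, of _ A] separated_flip[OF _ assms, of _ "- A"]
    card_crossing_flip[where A = A]
  by (auto simp: sep_matchings_def)

text \<open>If all edges of \<open>g\<close> are crossing and \<open>f\<close> has \<open>q\<close> crossing edges, then all edges of \<open>f\<close> are
  crossing too; a component with a single edge of \<open>f\<close> then consists of two equal edges, so \<open>f = g\<close>.\<close>

lemma card_sep_matchings_bicoloured:
  assumes fin: "finite M" and g: "g \<in> matchings M" and bi: "\<And>x. x \<in> M \<Longrightarrow> g x \<in> A \<longleftrightarrow> x \<notin> A"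
    and q: "card (M - A) = q"
  shows "card (sep_matchings M A g q) = 1"
proof -
  note gi = matchings_involution[OF g]
  have out: "crossing (- A) g = M - A"
    using bi crossing_subset[OF g, of "- A"] by (auto simp: crossing_def)
  have inn: "crossing A g = M \<inter> A"
    using bi crossing_subset[OF g, of A] by (auto simp: crossing_def)
  have q': "card (M \<inter> A) = q" using card_crossing_flip[OF g, of A] out inn q by simp
  have "sep_matchings M A g q = {g}"
  proof (intro equalityI subsetI)
    fix f assume "f \<in> sep_matchings M A g q"
    then have f: "f \<in> matchings M" and c: "card (crossing A f) = q" and s: "separated A f g"
      by (auto simp: sep_matchings_def)
    note fi = matchings_involution[OF f]
    have "crossing A f = M \<inter> A"
      by (rule card_subset_eq) (use fin crossing_subset[OF f] c q' in auto)
    then have fA: "f x \<notin> A" if "x \<in> M" "x \<in> A" for x using that by (auto simp: crossing_def)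
    have "crossing (- A) f = M - A"
      by (rule card_subset_eq)
        (use fin crossing_subset[OF f, of "- A"] c q card_crossing_flip[OF f, of A] in auto)
    then have fnA: "f x \<in> A" if "x \<in> M" "x \<notin> A" for x using that by (auto simp: crossing_def)
    have eqA: "f x = g x" if x: "x \<in> M" "x \<in> A" for x
    proof -
      have "f x \<in> M" using x matchings_in[OF f] by simp
      then have "g (f x) \<in> A" "g (f x) \<in> M" using bi fA x matchings_in[OF g] by auto
      then have "g (f x) \<in> crossing A f" "x \<in> crossing A f"
        using x fA by (auto simp: crossing_def)
      moreover have "(x, g (f x)) \<in> joined f g"
        by (metis joined_step1 joined_step2 joined_trans)
      ultimately have "x = g (f x)" using s by (auto simp: separated_def)
      then show ?thesis by (metis gi)
    qed
    have "f x = g x" for x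
    proof (cases "x \<in> M \<and> x \<notin> A")
      case True
      then have "f (f x) = g (f x)" using eqA fnA matchings_in[OF f] by auto
      then show ?thesis by (metis fi gi)
    next
      case False
      then show ?thesis using eqA matchings_moved[OF f] matchings_moved[OF g] by metis
    qed
    then show "f \<in> {g}" by auto
  next
    fix f assume "f \<in> {g}"
    then have [simp]: "f = g" by simp
    have "separated A g g" unfolding separated_def
    proof (intro ballI impI)
      fix x u assume x: "x \<in> crossing A g" and u: "u \<in> crossing A g" and "(x, u) \<in> joined g g"
      from this(3) have "u \<in> {x, g x}" by (rule joined_invariant) (use gi in auto)
      then show "x = u" using x u by (auto simp: crossing_def)
    qed
    then show "f \<in> sep_matchings M A g q" using g inn q' by (simp add: sep_matchings_def)
  qed
  then show ?thesis by simp
qed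

text \<open>All vertices outside \<open>A\<close> lie on crossing edges, both of \<open>g\<close> and of the counted matchings. The
  edges of \<open>g\<close> inside \<open>A\<close> are contracted one by one.\<close>

lemma card_sep_matchings_all_crossing:
  assumes "finite M" "g \<in> matchings M" "\<And>x. x \<in> M - A \<Longrightarrow> g x \<in> A" "card (M - A) = q"
  shows "card (sep_matchings M A g q) * dfact_odd q = dfact_odd (card M div 2)"
  using assms
proof (induction "card M" arbitrary: M g rule: less_induct)
  case less
  note fin = less.prems(1) and g = less.prems(2)
  note gi = matchings_involution[OF g]
  show ?case
  proof (cases "\<exists>a\<in>M \<inter> A. g a \<in> A")
    case True
    then obtain a where a: "a \<in> M" "a \<in> A" "g a \<in> A" by auto
    let ?b = "g a" and ?M = "M - {a, g a}" and ?g = "contract a (g a) g"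
    have b: "?b \<in> M" "?b \<noteq> a" using a matchings_in[OF g] matchings_moved[OF g] by auto
    have g': "?g \<in> matchings ?M" using contract_in_matchings[OF g] a b by auto
    have cM: "card M = card ?M + 2" using card_Diff_pair[OF fin] a b by auto
    have "card (sep_matchings ?M A ?g q) * dfact_odd q = dfact_odd (card ?M div 2)"
    proof (rule less.hyps)
      show "?g x \<in> A" if "x \<in> ?M - A" for x
        using that less.prems(3)[of x] a gi by (auto simp: contract_def)
      have "?M - A = M - A" using a by auto
      then show "card (?M - A) = q" using less.prems(4) by simp
    qed (use cM fin g' in auto)
    moreover have "card (sep_matchings M A g q) =
        (card (M - - A) + q - 1) * card (sep_matchings ?M A ?g q)"
      using card_sep_matchings_remove_edge[OF fin g \<open>a \<in> M\<close> refl, of "- A" q] a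
        sep_matchings_flip[OF g] sep_matchings_flip[OF g'] by auto
    moreover have "card (M - - A) + q = card M"
      using card_Int_Diff[OF fin, of A] less.prems(4) by (simp add: Diff_eq)
    moreover have "card M div 2 = Suc (card ?M div 2)" using cM by simp
    moreover have "2 * (card ?M div 2) + 1 = card M - 1"
      using cM even_card_matching[OF g'] fin by simp
    ultimately show ?thesis by simp
  next
    case False
    have bi: "g x \<in> A \<longleftrightarrow> x \<notin> A" if "x \<in> M" for x using False that less.prems(3) by auto
    have "M - A = crossing (- A) g" "M \<inter> A = crossing A g"
      using bi crossing_subset[OF g, of A] crossing_subset[OF g, of "- A"] by (auto simp: crossing_def)
    then have "card M = 2 * q"
      using card_Int_Diff[OF fin, of A] less.prems(4) card_crossing_flip[OF g, of A] by simp
    then show ?thesis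
      using card_sep_matchings_bicoloured[OF fin g bi less.prems(4)] by simp
  qed
qed

text \<open>Here an edge of the counted matching \<open>f\<close>, rather than one of \<open>g\<close>, is contracted. The position at
  which the edge is inserted into \<open>h\<close> is then fixed, so the correspondence is one-to-one.\<close>

lemma card_sep_matchings_containing:
  assumes g: "g \<in> matchings M" and a: "a \<in> M - A" and b: "b \<in> M - A" and ab: "a \<noteq> b"
  shows "card {f \<in> sep_matchings M A g q. f a = b} =
    card (sep_matchings (M - {a, b}) A (contract a b g) q)"
proof -
  have aM: "a \<in> M" "b \<in> M" and aA: "a \<notin> A" "b \<notin> A" using a b by auto
  have key: "crossing A (contract a b f) = crossing A f \<and>
      (separated A (contract a b f) (contract a b g) \<longleftrightarrow> separated A f g)"
    if f: "f \<in> matchings M" "f a = b" for f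
  proof -
    have cr: "crossing A (contract a b f) = crossing A f"
      using crossing_contract[OF f(1) aA] f aA by simp
    have "x \<notin> {a, b}" if "x \<in> crossing A f" for x using that aA by (auto simp: crossing_def)
    then show ?thesis
      unfolding separated_def joined_commute[of f] joined_commute[of "contract a b f"]
      using joined_contract[OF g f(1) \<open>a \<in> M\<close> f(2)] cr by simp
  qed
  have "bij_betw (contract a b) {f \<in> sep_matchings M A g q. f a = b}
      (sep_matchings (M - {a, b}) A (contract a b g) q)"
  proof (rule bij_betw_byWitness[where f' = "expand a b b"])
    show "\<forall>f\<in>{f \<in> sep_matchings M A g q. f a = b}. expand a b b (contract a b f) = f"
      using expand_contract[OF _ aM ab] by (auto simp: sep_matchings_def)
    show "\<forall>h\<in>sep_matchings (M - {a, b}) A (contract a b g) q. contract a b (expand a b b h) = h"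
      using contract_expand[OF _ aM ab] by (auto simp: sep_matchings_def)
    show "contract a b ` {f \<in> sep_matchings M A g q. f a = b}
        \<subseteq> sep_matchings (M - {a, b}) A (contract a b g) q"
      using key contract_in_matchings[OF _ aM ab] by (auto simp: sep_matchings_def)
    show "expand a b b ` sep_matchings (M - {a, b}) A (contract a b g) q
        \<subseteq> {f \<in> sep_matchings M A g q. f a = b}"
    proof (rule image_subsetI)
      fix h assume hV: "h \<in> sep_matchings (M - {a, b}) A (contract a b g) q"
      then have h: "h \<in> matchings (M - {a, b})" by (simp add: sep_matchings_def)
      have "expand a b b h \<in> matchings M" "contract a b (expand a b b h) = h"
        using expand_in_matchings[OF h aM ab] contract_expand[OF h aM ab] by auto
      then show "expand a b b h \<in> {f \<in> sep_matchings M A g q. f a = b}"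
        using key[of "expand a b b h"] hV by (simp add: sep_matchings_def expand_apply)
    qed
  qed
  then show ?thesis by (rule bij_betw_same_card)
qed

text \<open>Double counting of the ordered edges inside \<open>- A\<close>: a matching with \<open>q\<close> crossing edges leaves
  \<open>card (M - A) - q\<close> vertices outside \<open>A\<close> to be matched among themselves.\<close>

lemma sum_card_sep_matchings_containing:
  assumes fin: "finite M"
  shows "(card (M - A) - q) * card (sep_matchings M A g q) =
    (\<Sum>(a, b)\<in>{(a, b). a \<in> M - A \<and> b \<in> M - A \<and> a \<noteq> b}. card {f \<in> sep_matchings M A g q. f a = b})"
    (is "_ = (\<Sum>(a, b)\<in>?P. _)")
proof -
  let ?V = "sep_matchings M A g q"
  have finV: "finite ?V" using finite_sep_matchings[OF fin] .
  have finP: "finite ?P" by (rule finite_subset[of _ "M \<times> M"]) (use fin in auto)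
  have "card {a \<in> M - A. f a \<notin> A} = card (M - A) - q" if "f \<in> ?V" for f
  proof -
    have f: "f \<in> matchings M" "card (crossing (- A) f) = q"
      using that card_crossing_flip by (auto simp: sep_matchings_def)
    have "{a \<in> M - A. f a \<notin> A} = (M - A) - crossing (- A) f" by (auto simp: crossing_def)
    moreover have "crossing (- A) f \<subseteq> M - A" using crossing_subset[OF f(1), of "- A"] by auto
    ultimately show ?thesis using f(2) fin by (simp add: card_Diff_subset finite_subset)
  qed
  then have "(card (M - A) - q) * card ?V = (\<Sum>f\<in>?V. card {a \<in> M - A. f a \<notin> A})" by simp
  also have "\<dots> = card (SIGMA f:?V. {a \<in> M - A. f a \<notin> A})"
    using fin finV by (subst card_SigmaI) auto
  also have "\<dots> = card (SIGMA p:?P. {f \<in> ?V. f (fst p) = snd p})"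
  proof (rule bij_betw_same_card)
    have V: "f x \<in> M" "f x \<noteq> x" if "f \<in> ?V" "x \<in> M" for f x
      using that matchings_in[of f M] matchings_moved[of f M] by (auto simp: sep_matchings_def)
    show "bij_betw (\<lambda>(f, a). ((a, f a), f)) (SIGMA f:?V. {a \<in> M - A. f a \<notin> A})
        (SIGMA p:?P. {f \<in> ?V. f (fst p) = snd p})"
      by (rule bij_betw_byWitness[where f' = "\<lambda>(p, f). (f, fst p)"])
        (auto simp: V V(2)[symmetric])
  qed
  also have "\<dots> = (\<Sum>p\<in>?P. card {f \<in> ?V. f (fst p) = snd p})"
    using finP finV by (subst card_SigmaI) auto
  finally show ?thesis by (simp add: case_prod_unfold)
qed

lemma card_ordered_pairs:
  assumes "finite S"
  shows "card {(a, b). a \<in> S \<and> b \<in> S \<and> a \<noteq> b} = card S * (card S - 1)"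
proof -
  have "{(a, b). a \<in> S \<and> b \<in> S \<and> a \<noteq> b} = (SIGMA a:S. S - {a})" by auto
  then show ?thesis using assms by (simp add: card_SigmaI)
qed

lemma choose_times_dfact_odd_step:
  assumes "q + 2 \<le> r" "even (r + q)"
  shows "(r - q) * ((r choose q) * dfact_odd ((r - q) div 2)) =
    r * (r - 1) * ((r - 2 choose q) * dfact_odd ((r - 2 - q) div 2))"
proof -
  have "even (r - q - 2)" using assms by auto
  then obtain k where "r - q - 2 = 2 * k" by (elim evenE)
  then have k: "r = q + 2 * k + 2" using assms(1) by simp
  let ?D = "dfact_odd ((r - 2 - q) div 2)"
  have "dfact_odd ((r - q) div 2) = (r - 1 - q) * ?D" by (simp add: k)
  then have "(r - q) * ((r choose q) * dfact_odd ((r - q) div 2)) =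
      ((r - q) * (r choose q)) * ((r - 1 - q) * ?D)" by simp
  also have "(r - q) * (r choose q) = r * (r - 1 choose q)"
    using binomial_absorb_comp[of r q] by simp
  also have "r * (r - 1 choose q) * ((r - 1 - q) * ?D) = r * ((r - 1 - q) * (r - 1 choose q)) * ?D"
    by simp
  also have "(r - 1 - q) * (r - 1 choose q) = (r - 1) * (r - 2 choose q)"
    using binomial_absorb_comp[of "r - 1" q] by (simp add: numeral_2_eq_2)
  finally show ?thesis by simp
qed

lemma card_sep_matchings_no_outer_edges:
  assumes "finite M" "g \<in> matchings M" "\<And>x. x \<in> M - A \<Longrightarrow> g x \<in> A" "even (card (M - A) + q)"
  shows "card (sep_matchings M A g q) * dfact_odd q =
    (card (M - A) choose q) * dfact_odd ((card (M - A) - q) div 2) * dfact_odd ((card (M \<inter> A) + q) div 2)"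
  using assms
proof (induction "card M" arbitrary: M g rule: less_induct)
  case less
  note fin = less.prems(1) and g = less.prems(2)
  let ?r = "card (M - A)" and ?V = "sep_matchings M A g q"
  have "?r \<noteq> q + 1" using less.prems(4) by auto
  then consider "?r < q" | "?r = q" | "q + 2 \<le> ?r" by linarith
  then show ?case
  proof cases
    case 1
    have "?V = {}"
    proof (rule ccontr)
      assume "?V \<noteq> {}"
      then obtain f where f: "f \<in> matchings M" "card (crossing (- A) f) = q"
        using card_crossing_flip by (force simp: sep_matchings_def)
      have "card (crossing (- A) f) \<le> ?r"
        using crossing_subset[OF f(1), of "- A"] fin by (intro card_mono) auto
      with f 1 show False by simp
    qed
    with 1 show ?thesis by simp
  next
    case 2
    then have "card (M \<inter> A) + q = card M" using card_Int_Diff[OF fin, of A] by simp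
    with 2 show ?thesis
      using card_sep_matchings_all_crossing[OF fin g less.prems(3), of q] by simp
  next
    case 3
    let ?P = "{(a, b). a \<in> M - A \<and> b \<in> M - A \<and> a \<noteq> b}"
    let ?X = "(?r - 2 choose q) * dfact_odd ((?r - 2 - q) div 2) * dfact_odd ((card (M \<inter> A) + q) div 2)"
    have step: "card {f \<in> ?V. f a = b} * dfact_odd q = ?X" if p: "(a, b) \<in> ?P" for a b
    proof -
      have ab: "a \<in> M - A" "b \<in> M - A" "a \<noteq> b" using p by auto
      let ?M = "M - {a, b}" and ?g = "contract a b g"
      have g': "?g \<in> matchings ?M" using contract_in_matchings[OF g] ab by auto
      have "?M - A = (M - A) - {a, b}" by auto
      then have r': "?r = card (?M - A) + 2" using card_Diff_pair[of "M - A" a b] fin ab by simp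
      have i': "?M \<inter> A = M \<inter> A" using ab by auto
      have cM: "card M = card ?M + 2" using card_Diff_pair[OF fin] ab by auto
      have "card (sep_matchings ?M A ?g q) * dfact_odd q = ?X"
      proof (subst less.hyps)
        show "?g x \<in> A" if x: "x \<in> ?M - A" for x
        proof -
          have "g x \<in> A" "g a \<in> A" "g b \<in> A" using x ab less.prems(3) by auto
          then show ?thesis using x by (auto simp: contract_def)
        qed
        show "even (card (?M - A) + q)" using less.prems(4) r' by simp
      qed (use cM fin g' r' i' in auto)
      then show ?thesis using card_sep_matchings_containing[OF g ab] by simp
    qed
    have "(?r - q) * card ?V * dfact_odd q = (\<Sum>(a, b)\<in>?P. card {f \<in> ?V. f a = b} * dfact_odd q)"
      unfolding sum_card_sep_matchings_containing[OF fin]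
      by (simp add: sum_distrib_right case_prod_unfold)
    also have "\<dots> = (\<Sum>p\<in>?P. ?X)" by (rule sum.cong) (use step in auto)
    also have "\<dots> = ?r * (?r - 1) * ?X" using card_ordered_pairs[of "M - A"] fin by simp
    also have "\<dots> = (?r - q) * ((?r choose q) * dfact_odd ((?r - q) div 2)) *
        dfact_odd ((card (M \<inter> A) + q) div 2)"
      using choose_times_dfact_odd_step[OF 3 less.prems(4)] by (simp add: mult.assoc)
    finally have "(?r - q) * (card ?V * dfact_odd q) = (?r - q) *
        ((?r choose q) * dfact_odd ((?r - q) div 2) * dfact_odd ((card (M \<inter> A) + q) div 2))"
      by (simp add: mult.assoc)
    then show ?thesis using 3 by simp
  qed
qed

theorem card_sep_matchings:
  assumes "finite M" "g \<in> matchings M" "card (crossing A g) = r" "even (r + q)"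
  shows "card (sep_matchings M A g q) * (dfact_odd ((r + q) div 2) * dfact_odd q) =
    (r choose q) * (dfact_odd ((r - q) div 2) * dfact_odd ((card (M - A) + q) div 2)
      * dfact_odd ((card (M \<inter> A) + q) div 2))"
  using assms
proof (induction "card M" arbitrary: M g rule: less_induct)
  case less
  note fin = less.prems(1) and g = less.prems(2)
  show ?case
  proof (cases "\<exists>a\<in>M - A. g a \<notin> A")
    case True
    then obtain a where a: "a \<in> M" "a \<notin> A" "g a \<notin> A" by auto
    let ?b = "g a" and ?M = "M - {a, g a}" and ?g = "contract a (g a) g"
    have b: "?b \<in> M" "?b \<noteq> a" using a matchings_in[OF g] matchings_moved[OF g] by auto
    have g': "?g \<in> matchings ?M" using contract_in_matchings[OF g] a b by auto
    have cM: "card M = card ?M + 2" using card_Diff_pair[OF fin] a b by auto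
    have "?M - A = (M - A) - {a, ?b}" by auto
    then have m: "card (M - A) = card (?M - A) + 2"
      using card_Diff_pair[of "M - A" a ?b] fin a b by simp
    have i': "?M \<inter> A = M \<inter> A" using a by auto
    have cr: "crossing A ?g = crossing A g" using crossing_contract[OF g, of a A ?b] a by simp
    have "card (sep_matchings ?M A ?g q) * (dfact_odd ((r + q) div 2) * dfact_odd q) =
      (r choose q) * (dfact_odd ((r - q) div 2) * dfact_odd ((card (?M - A) + q) div 2)
        * dfact_odd ((card (?M \<inter> A) + q) div 2))"
      by (rule less.hyps) (use cM fin g' cr less.prems in auto)
    moreover have "card (sep_matchings M A g q) =
        (card (M - A) + q - 1) * card (sep_matchings ?M A ?g q)"
      using card_sep_matchings_remove_edge[OF fin g \<open>a \<in> M\<close> refl a(2,3)] .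
    moreover have "even (card (?M - A) + q)"
      using even_card_outside[OF g', of A] cr less.prems fin by (auto simp: even_add)
    then have "dfact_odd ((card (M - A) + q) div 2) =
        (card (M - A) + q - 1) * dfact_odd ((card (?M - A) + q) div 2)"
      using m by simp
    ultimately show ?thesis using i' by (simp add: algebra_simps)
  next
    case False
    then have "crossing (- A) g = M - A"
      using crossing_subset[OF g, of "- A"] by (auto simp: crossing_def)
    then have r: "card (M - A) = r" using less.prems(3) card_crossing_flip[OF g, of A] by simp
    then show ?thesis
      using card_sep_matchings_no_outer_edges[OF fin g, of A q] False less.prems(4)
      by (simp add: algebra_simps)
  qed
qed

section \<open>Products of three matchings and separation\<close>

text \<open>In the product \<open>\<alpha>\<sigma>\<alpha>\<close> the vertices lie on four rows: \<open>f\<close> is placed on rows 0 and 1 and once more on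
  rows 2 and 3, and \<open>g\<close> joins rows 1 and 2. Elements of \<open>A\<close> stand on rows 0 and 2, those of \<open>- A\<close> on
  rows 1 and 3. A set of vertices of this graph is a pair of predicates, \<open>P\<close> for the upper copy of
  \<open>f\<close> and \<open>Q\<close> for the lower one; it is consistent if it is a union of connected components. On the
  two middle rows it is \<open>Q\<close> on \<open>A\<close> and \<open>P\<close> on \<open>- A\<close>.\<close>

definition consistent ::
    "'a set \<Rightarrow> ('a \<Rightarrow> 'a) \<Rightarrow> ('a \<Rightarrow> 'a) \<Rightarrow> ('a \<Rightarrow> bool) \<Rightarrow> ('a \<Rightarrow> bool) \<Rightarrow> bool" where
  "consistent A f g P Q \<longleftrightarrow> (\<forall>v. P (f v) = P v) \<and> (\<forall>v. Q (f v) = Q v) \<and>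
     (\<forall>v. (if g v \<in> A then Q (g v) else P (g v)) = (if v \<in> A then Q v else P v))"

text \<open>Connectedness, in the four-row graph, of the vertices \<open>x\<close> and \<open>y\<close> on the outer rows 0 and 3, where
  the vertex sets above reduce to \<open>P\<close> on \<open>A\<close> and \<open>Q\<close> on \<open>- A\<close>.\<close>

definition triple_related :: "'a set \<Rightarrow> ('a \<Rightarrow> 'a) \<Rightarrow> ('a \<Rightarrow> 'a) \<Rightarrow> 'a \<Rightarrow> 'a \<Rightarrow> bool" where
  "triple_related A f g x y \<longleftrightarrow> (\<forall>P Q. consistent A f g P Q \<longrightarrow>
     (if x \<in> A then P x else Q x) \<longrightarrow> (if y \<in> A then P y else Q y))"

text \<open>The partial matching of the edges of \<open>f\<close> inside the colour classes. Together with \<open>g\<close> it makes up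
  the graph on the two middle rows.\<close>

definition noncrossing :: "'a set \<Rightarrow> ('a \<Rightarrow> 'a) \<Rightarrow> 'a \<Rightarrow> 'a" where
  "noncrossing A f v = (if v \<in> A \<longleftrightarrow> f v \<in> A then f v else v)"

lemma noncrossing_involution: "(\<And>x. f (f x) = x) \<Longrightarrow> noncrossing A f (noncrossing A f x) = x"
  by (auto simp: noncrossing_def)

lemma consistent_middle:
  assumes "consistent A f g P Q" "(x, y) \<in> joined (noncrossing A f) g"
  shows "(if x \<in> A then Q x else P x) \<longleftrightarrow> (if y \<in> A then Q y else P y)"
  using assms(2)
  by (rule joined_invariant) (use assms(1) in \<open>auto simp: consistent_def noncrossing_def\<close>)

lemma joined_noncrossing_subset:
  assumes "(x, y) \<in> joined (noncrossing A f) g"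
  shows "(x, y) \<in> joined f g"
  using assms
proof (rule joined_invariant)
  show "(x, noncrossing A f v) \<in> joined f g" if "(x, v) \<in> joined f g" for v
    using that joined_step1[of v f g] by (auto simp: noncrossing_def intro: joined_trans)
  show "(x, g v) \<in> joined f g" if "(x, v) \<in> joined f g" for v
    using that joined_step2[of v g f] by (auto intro: joined_trans)
qed auto

text \<open>The component \<open>C\<close> of \<open>z\<close> in the graph on the middle rows is perfectly matched by \<open>g\<close>, so it has
  even size, and the number of vertices of \<open>C\<close> unmatched by the non-crossing edges of \<open>f\<close> is even
  as well. As \<open>z\<close> is one of them, there is another; separation forces it to be \<open>f z\<close>.\<close>

lemma separated_path:
  assumes fin: "finite M" and f: "f \<in> matchings M" and g: "g \<in> matchings M"
    and sep: "separated A f g" and z: "z \<in> A \<longleftrightarrow> f z \<notin> A"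
  shows "(z, f z) \<in> joined (noncrossing A f) g"
proof -
  note fi = matchings_involution[OF f] and gi = matchings_involution[OF g]
  let ?h = "noncrossing A f"
  define C where "C = {v. (z, v) \<in> joined ?h g}"
  have zM: "z \<in> M" using z matchings_moved[OF f] by metis
  have Ch: "?h v \<in> C" if "v \<in> C" for v
    using that joined_step1[of v ?h g] by (auto simp: C_def intro: joined_trans)
  have Cg: "g v \<in> C" if "v \<in> C" for v
    using that joined_step2[of v g ?h] by (auto simp: C_def intro: joined_trans)
  have CM: "C \<subseteq> M"
  proof
    fix v assume "v \<in> C"
    then have "(z, v) \<in> joined ?h g" by (simp add: C_def)
    then show "v \<in> M"
      by (rule joined_invariant)
        (use zM matchings_in[OF f] matchings_in[OF g] in \<open>auto simp: noncrossing_def\<close>)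
  qed
  have finC: "finite C" using CM fin by (rule finite_subset)
  have "even (card C)"
    by (rule even_card_involution[OF finC, where f = g])
      (use Cg gi CM matchings_moved[OF g] in auto)
  moreover have "even (card {v \<in> C. ?h v \<noteq> v})"
    by (rule even_card_involution[where f = ?h]) (use finC Ch noncrossing_involution[of f A] fi in auto)
  moreover have "{v \<in> C. ?h v = v} = C - {v \<in> C. ?h v \<noteq> v}" by auto
  then have "card {v \<in> C. ?h v = v} = card C - card {v \<in> C. ?h v \<noteq> v}"
    using finC by (simp add: card_Diff_subset)
  ultimately have "even (card {v \<in> C. ?h v = v})" by simp
  moreover have "z \<in> {v \<in> C. ?h v = v}" using z by (auto simp: C_def noncrossing_def)
  ultimately have "{v \<in> C. ?h v = v} \<noteq> {z}" by auto
  with \<open>z \<in> {v \<in> C. ?h v = v}\<close> obtain w where w: "w \<in> C" "?h w = w" "w \<noteq> z" by blast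
  have wc: "w \<in> A \<longleftrightarrow> f w \<notin> A"
    using w CM matchings_moved[OF f] by (auto simp: noncrossing_def split: if_splits)
  have zw: "(z, w) \<in> joined f g" using w joined_noncrossing_subset by (auto simp: C_def)
  have "w = f z"
  proof (rule ccontr)
    assume ne: "w \<noteq> f z"
    let ?z = "if z \<in> A then z else f z" and ?w = "if w \<in> A then w else f w"
    have "(?z, z) \<in> joined f g" using joined_step1[of "f z" f g] fi by auto
    moreover have "(w, ?w) \<in> joined f g" using joined_step1[of w f g] by auto
    ultimately have "(?z, ?w) \<in> joined f g" using zw joined_trans by metis
    moreover have "?z \<in> crossing A f" "?w \<in> crossing A f" using z wc fi by (auto simp: crossing_def)
    ultimately have "?z = ?w" using sep by (auto simp: separated_def)
    then show False using ne w(3) fi by (metis (full_types))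
  qed
  with w show ?thesis by (simp add: C_def)
qed

lemma triple_related_if_separated:
  assumes fin: "finite M" and f: "f \<in> matchings M" and g: "g \<in> matchings M"
    and sep: "separated A f g" and x: "x \<in> M" and y: "y \<in> M"
  shows "triple_related A f g x y \<longleftrightarrow> y \<in> {x, f x}"
proof
  note fi = matchings_involution[OF f] and gi = matchings_involution[OF g]
  have inj: "f u = f v \<longleftrightarrow> u = v" for u v by (metis fi)
  {
    assume rel: "triple_related A f g x y"
    show "y \<in> {x, f x}"
    proof (cases "x \<in> A \<longleftrightarrow> f x \<in> A")
      case True
      \<comment> \<open>The block of \<open>x\<close> is a component of the four-row graph.\<close>
      let ?P = "\<lambda>v. x \<in> A \<and> v \<in> {x, f x}" and ?Q = "\<lambda>v. x \<notin> A \<and> v \<in> {x, f x}"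
      have "consistent A f g ?P ?Q" using True fi inj by (auto simp: consistent_def)
      then show ?thesis using rel unfolding triple_related_def by (auto split: if_splits)
    next
      case xc: False
      show ?thesis
      proof (cases "y \<in> A \<longleftrightarrow> f y \<in> A")
        case True
        \<comment> \<open>The block of \<open>y\<close> is a component; its complement contains \<open>x\<close>.\<close>
        let ?P = "\<lambda>v. \<not> (y \<in> A \<and> v \<in> {y, f y})" and ?Q = "\<lambda>v. \<not> (y \<notin> A \<and> v \<in> {y, f y})"
        have "consistent A f g ?P ?Q" using True fi inj by (auto simp: consistent_def)
        then have "(if x \<in> A then ?P x else ?Q x) \<longrightarrow> (if y \<in> A then ?P y else ?Q y)"
          using rel unfolding triple_related_def by blast
        moreover have "x \<noteq> y" "x \<noteq> f y" using xc True fi by auto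
        ultimately show ?thesis by (simp split: if_splits)
      next
        case yc: False
        \<comment> \<open>Gluing the four rows together projects connections to connections.\<close>
        let ?P = "\<lambda>v. (x, v) \<in> joined f g"
        have "?P (f v) = ?P v" for v
          using joined_step1[of v f g] joined_step1[of "f v" f g] fi by (metis joined_trans)
        moreover have "?P (g v) = ?P v" for v
          using joined_step2[of v g f] joined_step2[of "g v" g f] gi by (metis joined_trans)
        ultimately have "consistent A f g ?P ?P" by (simp add: consistent_def)
        then have xy: "(x, y) \<in> joined f g" using rel unfolding triple_related_def by fastforce
        let ?x = "if x \<in> A then x else f x" and ?y = "if y \<in> A then y else f y"
        have "(?x, x) \<in> joined f g" using joined_step1[of "f x" f g] fi by auto
        moreover have "(y, ?y) \<in> joined f g" using joined_step1[of y f g] by auto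
        ultimately have "(?x, ?y) \<in> joined f g" using xy joined_trans by metis
        moreover have "?x \<in> crossing A f" "?y \<in> crossing A f"
          using xc yc fi by (auto simp: crossing_def)
        ultimately have "?x = ?y" using sep by (auto simp: separated_def)
        then show ?thesis using fi by (metis (full_types) insertCI)
      qed
    qed
  }
  {
    assume "y \<in> {x, f x}"
    moreover have "triple_related A f g x x" by (simp add: triple_related_def)
    moreover have "triple_related A f g x (f x)"
      unfolding triple_related_def
    proof (intro allI impI)
      fix P Q assume c: "consistent A f g P Q" and zx: "if x \<in> A then P x else Q x"
      have P: "P (f v) = P v" and Q: "Q (f v) = Q v" for v using c by (auto simp: consistent_def)
      show "if f x \<in> A then P (f x) else Q (f x)"
      proof (cases "x \<in> A \<longleftrightarrow> f x \<in> A")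
        case True
        then show ?thesis using zx P Q by auto
      next
        case False
        then have "(x, f x) \<in> joined (noncrossing A f) g" by (intro separated_path[OF fin f g sep]) auto
        from consistent_middle[OF c this] show ?thesis using False zx P Q by (auto split: if_splits)
      qed
    qed
    ultimately show "triple_related A f g x y" by blast
  }
qed

text \<open>The converse. If the triple product is \<open>f\<close>, the two ends of each crossing edge are linked on the
  middle rows. Two crossing edges in one component of \<open>f\<close> and \<open>g\<close> would then be linked there as
  well, which would connect distinct blocks of \<open>f\<close> on the bottom row.\<close>

lemma separated_if_triple_related:
  assumes f: "f \<in> matchings M" and g: "g \<in> matchings M"
    and rel: "\<And>x y. x \<in> M \<Longrightarrow> y \<in> M \<Longrightarrow> triple_related A f g x y \<longleftrightarrow> y \<in> {x, f x}"
  shows "separated A f g"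
proof -
  note fi = matchings_involution[OF f] and gi = matchings_involution[OF g]
  let ?h = "noncrossing A f"
  have hi: "?h (?h v) = v" for v using noncrossing_involution[of f A] fi by auto
  have cM: "x \<in> M" if "x \<in> crossing A f" for x using crossing_subset[OF f] that by auto
  have path: "(f x, x) \<in> joined ?h g" if x: "x \<in> crossing A f" for x
  proof -
    define C where "C = {v. (f x, v) \<in> joined ?h g}"
    have Ch: "?h v \<in> C \<longleftrightarrow> v \<in> C" for v
      using joined_step1[of v ?h g] joined_step1[of "?h v" ?h g] hi
      unfolding C_def by (metis joined_trans mem_Collect_eq)
    have Cg: "g v \<in> C \<longleftrightarrow> v \<in> C" for v
      using joined_step2[of v g ?h] joined_step2[of "g v" g ?h] gi
      unfolding C_def by (metis joined_trans mem_Collect_eq)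
    have Cf: "f v \<in> C \<longleftrightarrow> v \<in> C" if "v \<in> A \<longleftrightarrow> f v \<in> A" for v
      using Ch[of v] that by (simp add: noncrossing_def)
    \<comment> \<open>All vertices of the four-row graph attached to the part \<open>C\<close> of the middle rows.\<close>
    let ?P = "\<lambda>v. if v \<in> A then f v \<notin> A \<and> f v \<in> C else v \<in> C"
    let ?Q = "\<lambda>v. if v \<in> A then v \<in> C else f v \<in> A \<and> f v \<in> C"
    have "consistent A f g ?P ?Q" using Cf Cg fi by (auto simp: consistent_def)
    moreover have "triple_related A f g x (f x)"
      using rel[of x "f x"] cM[OF x] matchings_in[OF f] by simp
    ultimately have "(if x \<in> A then ?P x else ?Q x) \<longrightarrow> (if f x \<in> A then ?P (f x) else ?Q (f x))"
      unfolding triple_related_def by blast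
    moreover have "f x \<in> C" by (simp add: C_def)
    ultimately have "x \<in> C" using x fi by (auto simp: crossing_def)
    then show ?thesis by (simp add: C_def)
  qed
  have path': "(x, f x) \<in> joined ?h g" if "x \<in> crossing A f" for x
    using joined_sym[OF hi gi path[OF that]] .
  have edge: "(v, f v) \<in> joined ?h g" for v
  proof (cases "v \<in> A \<longleftrightarrow> f v \<in> A")
    case True
    then show ?thesis using joined_step1[of v ?h g] by (simp add: noncrossing_def)
  next
    case False
    then have "v \<in> crossing A f \<or> f v \<in> crossing A f" using fi by (auto simp: crossing_def)
    then show ?thesis using path'[of v] path[of "f v"] fi by auto
  qed
  have joined_noncrossing: "(x, y) \<in> joined ?h g" if "(x, y) \<in> joined f g" for x y
    using that
    by (rule joined_invariant) (use edge joined_step2[of _ g ?h] in \<open>auto intro: joined_trans\<close>)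
  show ?thesis
    unfolding separated_def
  proof (intro ballI impI)
    fix x u assume x: "x \<in> crossing A f" and u: "u \<in> crossing A f" and "(x, u) \<in> joined f g"
    then have xu: "(x, u) \<in> joined ?h g" using joined_noncrossing by simp
    have A: "x \<in> A" "f x \<notin> A" "u \<in> A" "f u \<notin> A" using x u by (auto simp: crossing_def)
    have "triple_related A f g (f x) (f u)"
      unfolding triple_related_def
    proof (intro allI impI)
      fix P Q assume c: "consistent A f g P Q" and "if f x \<in> A then P (f x) else Q (f x)"
      then have "Q x" using A by (simp add: consistent_def)
      then have "Q u" using consistent_middle[OF c xu] A by simp
      then show "if f u \<in> A then P (f u) else Q (f u)" using A c by (simp add: consistent_def)
    qed
    then have "f u \<in> {f x, x}"
      using rel[of "f x" "f u"] cM[OF x] cM[OF u] matchings_in[OF f] fi by simp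
    then show "x = u" using A fi by (metis insertE singletonD)
  qed
qed

section \<open>Brauer partitions as matchings\<close>

text \<open>The partition of \<open>M\<close> into the edges of \<open>f\<close>.\<close>

definition blocks :: "'a set \<Rightarrow> ('a \<Rightarrow> 'a) \<Rightarrow> 'a set set" where
  "blocks M f = (\<lambda>x. {x, f x}) ` M"

text \<open>Exchange of the two rows. It turns a matching for \<open>\<sigma>\<close>, on \<open>vertices n m\<close>, into one on the vertex
  set \<open>vertices m n\<close> of \<open>\<alpha>\<close>.\<close>

fun flip :: "vertex \<Rightarrow> vertex" where
  "flip (Unprimed i) = Primed i"
| "flip (Primed i) = Unprimed i"
| "flip (DPrimed i) = DPrimed i"

lemma flip_flip [simp]: "flip (flip v) = v"
  by (cases v) auto

lemma bij_betw_blocks: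
  "bij_betw (blocks M) (matchings M) {\<alpha>. partition_on M \<alpha> \<and> (\<forall>B\<in>\<alpha>. card B = 2)}"
  unfolding bij_betw_def
proof (intro conjI equalityI subsetI)
  show "inj_on (blocks M) (matchings M)"
  proof (rule inj_onI)
    fix f f' assume f: "f \<in> matchings M" and f': "f' \<in> matchings M" and eq: "blocks M f = blocks M f'"
    show "f = f'"
    proof
      fix x
      show "f x = f' x"
      proof (cases "x \<in> M")
        case True
        then have "{x, f x} \<in> blocks M f'" using eq by (auto simp: blocks_def)
        then obtain y where "{x, f x} = {y, f' y}" by (auto simp: blocks_def)
        then show ?thesis using matchings_involution[OF f'] by (metis doubleton_eq_iff)
      next
        case False
        then show ?thesis using matchings_moved[OF f] matchings_moved[OF f'] by metis
      qed
    qed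
  qed
next
  fix \<alpha> assume "\<alpha> \<in> blocks M ` matchings M"
  then obtain f where f: "f \<in> matchings M" and \<alpha>: "\<alpha> = blocks M f" by auto
  note fi = matchings_involution[OF f]
  have "partition_on M \<alpha>"
  proof (rule partition_onI)
    show "\<Union>\<alpha> = M" using matchings_in[OF f] by (auto simp: \<alpha> blocks_def)
    show "{} \<notin> \<alpha>" by (auto simp: \<alpha> blocks_def)
    show "disjnt B C" if BC: "B \<in> \<alpha>" "C \<in> \<alpha>" "B \<noteq> C" for B C
    proof -
      obtain x y where xy: "B = {x, f x}" "C = {y, f y}" using BC by (auto simp: \<alpha> blocks_def)
      have "B = C" if "z \<in> B" "z \<in> C" for z
      proof -
        have "f z \<in> {x, f x}" "f z \<in> {y, f y}" using that xy fi by auto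
        then have "B = {z, f z}" "C = {z, f z}"
          using that xy fi by (metis doubleton_eq_iff empty_iff insert_iff)+
        then show ?thesis by simp
      qed
      then show ?thesis using BC(3) by (auto simp: disjnt_def)
    qed
  qed
  moreover have "card B = 2" if "B \<in> \<alpha>" for B
  proof -
    from that obtain x where "x \<in> M" "B = {x, f x}" by (auto simp: \<alpha> blocks_def)
    moreover from this have "f x \<noteq> x" using matchings_moved[OF f] by simp
    ultimately show ?thesis by (simp add: card_insert_if)
  qed
  ultimately show "\<alpha> \<in> {\<alpha>. partition_on M \<alpha> \<and> (\<forall>B\<in>\<alpha>. card B = 2)}" by simp
next
  fix \<alpha> assume "\<alpha> \<in> {\<alpha>. partition_on M \<alpha> \<and> (\<forall>B\<in>\<alpha>. card B = 2)}"
  then have part: "partition_on M \<alpha>" and two: "\<And>B. B \<in> \<alpha> \<Longrightarrow> card B = 2" by auto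
  have "\<exists>y. y \<noteq> x \<and> {x, y} \<in> \<alpha>" if "x \<in> M" for x
  proof -
    from part that obtain B where B: "B \<in> \<alpha>" "x \<in> B" by (auto simp: partition_on_def)
    then obtain y where "B = {x, y}" "y \<noteq> x" using two[OF B(1)] by (auto simp: card_2_iff)
    with B show ?thesis by auto
  qed
  then obtain p where p: "\<And>x. x \<in> M \<Longrightarrow> p x \<noteq> x \<and> {x, p x} \<in> \<alpha>" by metis
  define f where "f x = (if x \<in> M then p x else x)" for x
  have uniq: "B = C" if "B \<in> \<alpha>" "C \<in> \<alpha>" "x \<in> B" "x \<in> C" for B C x
    using that part by (auto simp: partition_on_def disjoint_def)
  have pM: "p x \<in> M" if "x \<in> M" for x
    using p[OF that] part by (auto simp: partition_on_def)
  have pp: "p (p x) = x" if "x \<in> M" for x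
  proof -
    have "{x, p x} = {p x, p (p x)}"
      by (rule uniq[of _ _ "p x"]) (use p[OF that] p[OF pM[OF that]] in auto)
    then show ?thesis by (metis doubleton_eq_iff)
  qed
  have "f \<in> matchings M" using p pM pp by (auto simp: matchings_def f_def)
  moreover have "\<alpha> = blocks M f"
  proof (intro equalityI subsetI)
    fix B assume B: "B \<in> \<alpha>"
    then have "B \<noteq> {}" "B \<subseteq> M" using part by (auto simp: partition_on_def)
    then obtain x where "x \<in> B" "x \<in> M" by auto
    then have "B = {x, f x}" using uniq[OF B, of "{x, f x}" x] p by (simp add: f_def)
    with \<open>x \<in> M\<close> show "B \<in> blocks M f" by (auto simp: blocks_def)
  qed (use p in \<open>auto simp: blocks_def f_def\<close>)
  ultimately show "\<alpha> \<in> blocks M ` matchings M" by auto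
qed

lemma product_graph_lower:
  "B \<in> \<alpha> \<Longrightarrow> x \<in> B \<Longrightarrow> y \<in> B \<Longrightarrow> (lower x, lower y) \<in> product_graph \<alpha> \<beta>"
  by (auto simp: product_graph_def block_edges_def)

lemma product_graph_raise:
  "B \<in> \<beta> \<Longrightarrow> x \<in> B \<Longrightarrow> y \<in> B \<Longrightarrow> (raise x, raise y) \<in> product_graph \<alpha> \<beta>"
  by (auto simp: product_graph_def block_edges_def)

lemma product_graph_invariant:
  assumes "(v, w) \<in> (product_graph \<alpha> \<beta>)\<^sup>*"
    and "\<And>B x y. B \<in> \<alpha> \<Longrightarrow> x \<in> B \<Longrightarrow> y \<in> B \<Longrightarrow> F (lower x) = F (lower y)"
    and "\<And>B x y. B \<in> \<beta> \<Longrightarrow> x \<in> B \<Longrightarrow> y \<in> B \<Longrightarrow> F (raise x) = F (raise y)"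
  shows "F v = F w"
  using assms(1)
proof (induction rule: rtrancl_induct)
  case (step w w')
  then consider
      B x y where "B \<in> \<alpha>" "x \<in> B" "y \<in> B" "w = lower x" "w' = lower y"
    | B x y where "B \<in> \<beta>" "x \<in> B" "y \<in> B" "w = raise x" "w' = raise y"
    unfolding product_graph_def block_edges_def by blast
  then have "F w = F w'"
  proof cases
    case 1
    then show ?thesis using assms(2)[OF 1(1-3)] by simp
  next
    case 2
    then show ?thesis using assms(3)[OF 2(1-3)] by simp
  qed
  with step show ?case by simp
qed simp

lemma sym_product_graph: "sym (product_graph \<alpha> \<beta>)"
  by (auto simp: sym_def product_graph_def block_edges_def)

text \<open>Two elements are in a common block of a product iff they are connected in the product graph.\<close>

lemma brauer_prod_block:
  assumes "B \<in> brauer_prod m k \<alpha> \<beta>" "x \<in> B" "y \<in> B"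
  shows "x \<in> vertices m k" "y \<in> vertices m k" "(x, y) \<in> (product_graph \<alpha> \<beta>)\<^sup>*"
proof -
  obtain z where "(z, x) \<in> (product_graph \<alpha> \<beta>)\<^sup>*" "(z, y) \<in> (product_graph \<alpha> \<beta>)\<^sup>*"
    "x \<in> vertices m k" "y \<in> vertices m k"
    using assms by (auto simp: brauer_prod_def quotient_def)
  then show "x \<in> vertices m k" "y \<in> vertices m k" "(x, y) \<in> (product_graph \<alpha> \<beta>)\<^sup>*"
    using sym_rtrancl[OF sym_product_graph] by (auto dest: symD intro: rtrancl_trans)
qed

lemma brauer_prod_block_exists:
  assumes "x \<in> vertices m k" "y \<in> vertices m k" "(x, y) \<in> (product_graph \<alpha> \<beta>)\<^sup>*"
  shows "\<exists>B\<in>brauer_prod m k \<alpha> \<beta>. x \<in> B \<and> y \<in> B"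
proof
  let ?R = "{(x, y). x \<in> vertices m k \<and> y \<in> vertices m k \<and> (x, y) \<in> (product_graph \<alpha> \<beta>)\<^sup>*}"
  show "?R `` {x} \<in> brauer_prod m k \<alpha> \<beta>"
    unfolding brauer_prod_def using assms(1) by (rule quotientI)
  show "x \<in> ?R `` {x} \<and> y \<in> ?R `` {x}" using assms by simp
qed

lemma brauer_prod_eq_blocks_iff:
  "brauer_prod m k \<alpha> \<beta> = blocks (vertices m k) f \<longleftrightarrow>
    (\<forall>x\<in>vertices m k. {y \<in> vertices m k. (x, y) \<in> (product_graph \<alpha> \<beta>)\<^sup>*} = {x, f x})"
    (is "?L \<longleftrightarrow> ?R") if f: "f \<in> matchings (vertices m k)"
proof -
  let ?V = "vertices m k"
  let ?c = "\<lambda>x. {y \<in> ?V. (x, y) \<in> (product_graph \<alpha> \<beta>)\<^sup>*}"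
  have prod: "brauer_prod m k \<alpha> \<beta> = ?c ` ?V"
    by (auto simp: brauer_prod_def quotient_def Image_def)
  show ?thesis
  proof
    assume L: ?L
    show ?R
    proof
      fix x assume x: "x \<in> ?V"
      then have "?c x \<in> blocks ?V f" using L prod by auto
      then obtain y where y: "?c x = {y, f y}" by (auto simp: blocks_def)
      have "x \<in> ?c x" using x by simp
      then show "?c x = {x, f x}" using y matchings_involution[OF f] by auto
    qed
  next
    assume ?R
    then show ?L unfolding prod blocks_def by (intro image_cong) auto
  qed
qed

lemma finite_vertices: "finite (vertices k l)"
  by (simp add: vertices_def)

lemma flip_vertices: "flip v \<in> vertices n m \<longleftrightarrow> v \<in> vertices m n"
  by (cases v) (auto simp: vertices_def)

context
  fixes m n :: nat and s g :: "vertex \<Rightarrow> vertex"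
  assumes s: "s \<in> matchings (vertices n m)" and g: "g = (\<lambda>v. flip (s (flip v)))"
begin

lemma g_in_matchings: "g \<in> matchings (vertices m n)"
proof -
  have "g v \<noteq> v \<longleftrightarrow> s (flip v) \<noteq> flip v" for v by (metis flip_flip g)
  then show ?thesis
    using matchings_involution[OF s] matchings_moved[OF s] flip_vertices
    by (simp add: matchings_def g)
qed

lemma card_crossing_reflected:
  "card (crossing (range Unprimed) g) = card (crossing (range Unprimed) s)"
proof -
  have "crossing (range Unprimed) g = flip ` crossing (- range Unprimed) s"
  proof (intro equalityI subsetI)
    fix v assume "v \<in> crossing (range Unprimed) g"
    then obtain i where i: "v = Unprimed i" "g v \<notin> range Unprimed" "g v \<noteq> v"
      by (auto simp: crossing_def)
    then have "s (Primed i) \<noteq> Primed i" "flip (s (Primed i)) \<notin> range Unprimed"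
      by (auto simp: g)
    moreover from this(1) have "s (Primed i) \<in> vertices n m"
      using matchings_in[OF s] matchings_moved[OF s] by blast
    ultimately have "s (Primed i) \<in> range Unprimed" by (auto simp: vertices_def)
    then show "v \<in> flip ` crossing (- range Unprimed) s"
      using i by (intro image_eqI[of _ _ "Primed i"]) (auto simp: crossing_def)
  next
    fix v assume "v \<in> flip ` crossing (- range Unprimed) s"
    then obtain w where w: "v = flip w" "w \<notin> range Unprimed" "s w \<in> range Unprimed"
      by (auto simp: crossing_def)
    then have "w \<in> vertices n m" using matchings_moved[OF s] by metis
    then show "v \<in> crossing (range Unprimed) g"
      using w by (auto simp: crossing_def g vertices_def)
  qed
  moreover have "inj_on flip S" for S by (metis flip_flip inj_onI)
  ultimately show ?thesis using card_crossing_flip[OF s] by (simp add: card_image)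
qed

end

context
  fixes m n :: nat and f s g :: "vertex \<Rightarrow> vertex"
  assumes f: "f \<in> matchings (vertices m n)" and s: "s \<in> matchings (vertices n m)"
    and g: "g = (\<lambda>v. flip (s (flip v)))"
begin

abbreviation (input) "prod2 \<equiv> brauer_prod m m (blocks (vertices m n) f) (blocks (vertices n m) s)"

text \<open>A consistent pair yields a set \<open>H\<close> of vertices closed under the product graph of the first two
  factors, and from it a set \<open>Z\<close> closed under the product graph of all three.\<close>

lemma triple_related_of_connected:
  assumes xy: "(x, y) \<in> (product_graph prod2 (blocks (vertices m n) f))\<^sup>*"
    and x: "x \<in> vertices m n" and y: "y \<in> vertices m n"
  shows "triple_related (range Unprimed) f g x y"
  unfolding triple_related_def
proof (intro allI impI)
  fix P Q assume c: "consistent (range Unprimed) f g P Q"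
    and Zx: "if x \<in> range Unprimed then P x else Q x"
  define H where "H v = (case v of Unprimed i \<Rightarrow> P (Unprimed i) | DPrimed i \<Rightarrow> P (Primed i)
    | Primed i \<Rightarrow> Q (Unprimed i))" for v
  define Z where "Z v = (case v of Unprimed i \<Rightarrow> P (Unprimed i) | DPrimed i \<Rightarrow> Q (Unprimed i)
    | Primed i \<Rightarrow> Q (Primed i))" for v
  have Pf: "P (f v) = P v" and Qf: "Q (f v) = Q v" for v using c by (auto simp: consistent_def)
  let ?W = "\<lambda>v. if v \<in> range Unprimed then Q v else P v"
  have Wg: "?W (g v) = ?W v" for v using c unfolding consistent_def by blast
  have fV: "f v \<in> vertices m n \<longleftrightarrow> v \<in> vertices m n"
    and sV: "s v \<in> vertices n m \<longleftrightarrow> v \<in> vertices n m" for v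
    using matchings_in[OF f] matchings_in[OF s] by auto
  have Hl: "H (lower v) = P v" if "v \<in> vertices m n" for v
    using that by (auto simp: H_def vertices_def)
  have Hr: "H (raise v) = ?W (flip v)" if "v \<in> vertices n m" for v
    using that by (auto simp: H_def vertices_def)
  have Hinv: "H v = H w" if "(v, w) \<in> (product_graph (blocks (vertices m n) f) (blocks (vertices n m) s))\<^sup>*" for v w
    using that
  proof (rule product_graph_invariant)
    show "H (lower x) = H (lower y)" if "B \<in> blocks (vertices m n) f" "x \<in> B" "y \<in> B" for B x y
      using that by (auto simp: blocks_def Hl Pf fV)
    have "?W (flip (s v)) = ?W (flip v)" for v using Wg[of "flip v"] unfolding g flip_flip .
    then show "H (raise x) = H (raise y)" if "B \<in> blocks (vertices n m) s" "x \<in> B" "y \<in> B" for B x y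
      using that by (auto simp only: blocks_def Hr sV image_iff insert_iff empty_iff)
  qed
  have Zl: "Z (lower v) = H v" if "v \<in> vertices m m" for v
    using that by (auto simp: H_def Z_def vertices_def)
  have Zr: "Z (raise v) = Q v" if "v \<in> vertices m n" for v
    using that by (auto simp: Z_def vertices_def)
  have "Z x = Z y"
    using xy
  proof (rule product_graph_invariant)
    show "Z (lower x) = Z (lower y)" if "B \<in> prod2" "x \<in> B" "y \<in> B" for B x y
      using brauer_prod_block[OF that] Zl Hinv by auto
    show "Z (raise x) = Z (raise y)" if "B \<in> blocks (vertices m n) f" "x \<in> B" "y \<in> B" for B x y
      using that by (auto simp: blocks_def Zr Qf fV)
  qed
  moreover have "Z v \<longleftrightarrow> (if v \<in> range Unprimed then P v else Q v)" if "v \<in> vertices m n" for v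
    using that by (auto simp: Z_def vertices_def)
  ultimately show "if y \<in> range Unprimed then P y else Q y" using Zx x y by simp
qed

text \<open>The vertices connected to \<open>x\<close> form a consistent pair. A vertex on the second row does not occur
  in the product graph of \<open>\<alpha>\<sigma>\<close> and \<open>\<alpha>\<close>, so connection to it is expressed by \<open>H\<close>: it is joined,
  within \<open>\<alpha>\<close> and \<open>\<sigma>\<close>, to a vertex of \<open>\<alpha>\<sigma>\<close> that is connected to \<open>x\<close>.\<close>

lemma connected_of_triple_related:
  assumes rel: "triple_related (range Unprimed) f g x y"
    and x: "x \<in> vertices m n" and y: "y \<in> vertices m n"
  shows "(x, y) \<in> (product_graph prod2 (blocks (vertices m n) f))\<^sup>*"
proof -
  let ?G1 = "product_graph (blocks (vertices m n) f) (blocks (vertices n m) s)"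
  let ?G2 = "product_graph prod2 (blocks (vertices m n) f)"
  define K where "K v \<longleftrightarrow> (x, v) \<in> ?G2\<^sup>*" for v
  define H where "H w \<longleftrightarrow> (\<exists>z\<in>vertices m m. (z, w) \<in> ?G1\<^sup>* \<and> K (lower z))" for w
  have Kedge: "K v = K w" if "(v, w) \<in> ?G2" for v w
  proof -
    have "(w, v) \<in> ?G2" using that sym_product_graph by (auto dest: symD)
    with that show ?thesis unfolding K_def by (auto intro: rtrancl_into_rtrancl)
  qed
  have Hedge: "H v = H w" if "(v, w) \<in> ?G1" for v w
  proof -
    have "(w, v) \<in> ?G1" using that sym_product_graph by (auto dest: symD)
    with that show ?thesis unfolding H_def by (auto intro: rtrancl_into_rtrancl)
  qed
  have HK: "H z = K (lower z)" if z: "z \<in> vertices m m" for z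
  proof
    assume "H z"
    then obtain z0 where z0: "z0 \<in> vertices m m" "(z0, z) \<in> ?G1\<^sup>*" "K (lower z0)"
      by (auto simp: H_def)
    then obtain B where "B \<in> prod2" "z0 \<in> B" "z \<in> B" using brauer_prod_block_exists z by blast
    then have "(lower z0, lower z) \<in> ?G2" by (rule product_graph_lower)
    then show "K (lower z)" using Kedge z0 by auto
  qed (use z in \<open>auto simp: H_def\<close>)
  let ?P = "\<lambda>v. H (lower v)" and ?Q = "\<lambda>v. K (raise v)"
  have vm: "Unprimed i \<in> vertices k l \<longleftrightarrow> i \<in> {1..k}" "Primed i \<in> vertices k l \<longleftrightarrow> i \<in> {1..l}" for i k l
    by (auto simp: vertices_def)
  have "?P (f v) = ?P v" for v
  proof (cases "v \<in> vertices m n")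
    case True
    then show ?thesis
      by (intro Hedge product_graph_lower[of "{v, f v}"]) (auto simp: blocks_def)
  next
    case False
    then have "f v = v" using matchings_moved[OF f] by simp
    then show ?thesis by simp
  qed
  moreover have "?Q (f v) = ?Q v" for v
  proof (cases "v \<in> vertices m n")
    case True
    then show ?thesis
      by (intro Kedge product_graph_raise[of "{v, f v}"]) (auto simp: blocks_def)
  next
    case False
    then have "f v = v" using matchings_moved[OF f] by simp
    then show ?thesis by simp
  qed
  moreover have "(if g v \<in> range Unprimed then ?Q (g v) else ?P (g v)) =
      (if v \<in> range Unprimed then ?Q v else ?P v)" for v
  proof (cases "flip v \<in> vertices n m")
    case True
    have W: "(if w \<in> range Unprimed then ?Q w else ?P w) = H (raise (flip w))"
      if w: "flip w \<in> vertices n m" for w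
    proof (cases w)
      case (Unprimed i)
      then have "Primed i \<in> vertices m m" using w by (simp add: vm)
      from HK[OF this] show ?thesis using Unprimed by simp
    qed auto
    have "H (raise (s (flip v))) = H (raise (flip v))"
      using True by (intro Hedge product_graph_raise[of "{flip v, s (flip v)}"]) (auto simp: blocks_def)
    moreover have "flip (g v) \<in> vertices n m" using True matchings_in[OF s] by (simp add: g)
    ultimately show ?thesis using W[OF True] W[of "g v"] by (simp add: g)
  next
    case False
    then have "s (flip v) = flip v" using matchings_moved[OF s] by simp
    then have "g v = v" by (simp add: g)
    then show ?thesis by simp
  qed
  ultimately have "consistent (range Unprimed) f g ?P ?Q" unfolding consistent_def by blast
  then have imp: "(if x \<in> range Unprimed then ?P x else ?Q x) \<longrightarrow>
      (if y \<in> range Unprimed then ?P y else ?Q y)"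
    using rel unfolding triple_related_def by blast
  have "(if v \<in> range Unprimed then ?P v else ?Q v) = K v" if v: "v \<in> vertices m n" for v
  proof (cases v)
    case (Unprimed i)
    then have "Unprimed i \<in> vertices m m" using v by (simp add: vm)
    from HK[OF this] show ?thesis using Unprimed by simp
  qed (use v in \<open>auto simp: vertices_def\<close>)
  moreover have "K x" by (simp add: K_def)
  ultimately have "K y" using imp x y by simp
  then show ?thesis by (simp add: K_def)
qed

text \<open>The criterion for idempotents: \<open>\<alpha>\<close> is idempotent iff every cycle of the glued graph contains at
  most one transversal of \<open>\<alpha>\<close>.\<close>

lemma sandwich_idempotent_iff:
  "sandwich m n (blocks (vertices n m) s) (blocks (vertices m n) f) (blocks (vertices m n) f) =
      blocks (vertices m n) f \<longleftrightarrow> separated (range Unprimed) f g"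
    (is "?L \<longleftrightarrow> ?R")
proof -
  let ?V = "vertices m n"
  have "?L \<longleftrightarrow> (\<forall>x\<in>?V. {y \<in> ?V. triple_related (range Unprimed) f g x y} = {x, f x})"
    unfolding sandwich_def brauer_prod_eq_blocks_iff[OF f]
    by (intro ball_cong arg_cong2[where f = "(=)"] Collect_cong)
      (use triple_related_of_connected connected_of_triple_related in blast)+
  also have "\<dots> \<longleftrightarrow> (\<forall>x\<in>?V. \<forall>y\<in>?V. triple_related (range Unprimed) f g x y \<longleftrightarrow> y \<in> {x, f x})"
    using matchings_in[OF f] by auto
  also have "\<dots> \<longleftrightarrow> ?R"
    using triple_related_if_separated[OF finite_vertices f g_in_matchings[OF s g]]
      separated_if_triple_related[OF f g_in_matchings[OF s g]] by blast
  finally show ?thesis .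
qed

end

lemma brauer_rank_blocks:
  assumes f: "f \<in> matchings (vertices m n)"
  shows "brauer_rank (blocks (vertices m n) f) = card (crossing (range Unprimed) f)"
proof -
  let ?U = "range Unprimed"
  note fi = matchings_involution[OF f]
  have "{B \<in> blocks (vertices m n) f. B \<inter> ?U \<noteq> {} \<and> B \<inter> range Primed \<noteq> {}} =
      (\<lambda>x. {x, f x}) ` crossing ?U f"
  proof (intro equalityI subsetI)
    fix B assume "B \<in> {B \<in> blocks (vertices m n) f. B \<inter> ?U \<noteq> {} \<and> B \<inter> range Primed \<noteq> {}}"
    then obtain x where B: "B = {x, f x}" and "B \<inter> ?U \<noteq> {}" "B \<inter> range Primed \<noteq> {}"
      unfolding blocks_def by blast
    moreover have "?U \<inter> range Primed = {}" by auto
    ultimately have ne: "x \<in> ?U \<longleftrightarrow> f x \<notin> ?U" by blast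
    show "B \<in> (\<lambda>x. {x, f x}) ` crossing ?U f"
    proof (cases "x \<in> ?U")
      case True
      then have "x \<in> crossing ?U f" using ne by (simp add: crossing_def)
      then show ?thesis using B by auto
    next
      case False
      then have "f x \<in> crossing ?U f" using ne fi by (simp add: crossing_def)
      moreover have "B = {f x, f (f x)}" using B fi by auto
      ultimately show ?thesis by blast
    qed
  next
    fix B assume "B \<in> (\<lambda>x. {x, f x}) ` crossing ?U f"
    then obtain x where x: "x \<in> crossing ?U f" and B: "B = {x, f x}" by auto
    have xV: "x \<in> vertices m n" using crossing_subset[OF f] x by auto
    then have "f x \<in> vertices m n" using matchings_in[OF f] by simp
    then have "f x \<in> range Primed" using x by (auto simp: crossing_def vertices_def)
    then show "B \<in> {B \<in> blocks (vertices m n) f. B \<inter> ?U \<noteq> {} \<and> B \<inter> range Primed \<noteq> {}}"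
      using B xV x by (auto simp: blocks_def crossing_def)
  qed
  moreover have "inj_on (\<lambda>x. {x, f x}) (crossing ?U f)"
    by (rule inj_onI) (auto simp: crossing_def doubleton_eq_iff)
  ultimately show ?thesis by (simp add: brauer_rank_def card_image)
qed

lemma odd_dfact_eq:
  assumes "k = 2 * int j - 1"
  shows "odd_dfact k = int (dfact_odd j)"
proof -
  have "{i \<in> {1..k}. odd i} = (\<lambda>i. 2 * int i + 1) ` {..<j}"
  proof (intro equalityI subsetI)
    fix i assume "i \<in> {i \<in> {1..k}. odd i}"
    then have i: "1 \<le> i" "i \<le> 2 * int j - 1" "odd i" using assms by auto
    then obtain t where t: "i = 2 * t + 1" by (elim oddE)
    then have "i = 2 * int (nat t) + 1" "nat t < j" using i by auto
    then show "i \<in> (\<lambda>i. 2 * int i + 1) ` {..<j}" by blast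
  qed (use assms in auto)
  moreover have "inj_on (\<lambda>i. 2 * int i + 1) {..<j}" by (auto simp: inj_on_def)
  ultimately show ?thesis
    by (simp add: odd_dfact_def dfact_odd_def prod.reindex of_nat_prod add.commute)
qed

lemma odd_dfact_pred_even:
  assumes "even j" "k = int j - 1"
  shows "odd_dfact k = int (dfact_odd (j div 2))"
  using assms by (intro odd_dfact_eq) (auto elim!: evenE)

section \<open>The number of idempotents\<close>

lemma idempotents_subset_regulars: "idempotents T h \<subseteq> regulars T h"
  by (force simp: idempotents_def regulars_def)

lemma bij_betw_blocks_brauer:
  "bij_betw (blocks (vertices m n)) (matchings (vertices m n)) (brauer m n)"
  unfolding brauer_def by (rule bij_betw_blocks)

lemma brauer_eq_blocks: "brauer m n = blocks (vertices m n) ` matchings (vertices m n)"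
  using bij_betw_imp_surj_on[OF bij_betw_blocks_brauer] by simp

theorem theorem6p21:
  fixes m n r :: nat and \<sigma> :: "vertex set set"
  assumes "[m = n] (mod 2)"
    and "\<sigma> \<in> brauer n m"
    and "r = brauer_rank \<sigma>"
  shows "let t = (\<lambda>q::nat. real (r choose q) *
               (real_of_int (odd_dfact (int r - int q - 1))
                * real_of_int (odd_dfact (int m + int q - 1))
                * real_of_int (odd_dfact (int n + int q - 1)))
             / (real_of_int (odd_dfact (int r + int q - 1))
                * real_of_int (odd_dfact (2 * int q - 1))))
    in real (card (idempotents (brauer m n) (sandwich m n \<sigma>)))
         = (\<Sum>q\<in>{q\<in>{0..r}. [q = r] (mod 2)}. t q)
     \<and> (\<forall>q\<in>{0..r}. [q = r] (mod 2) \<longrightarrow>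
           real (card (idempotents (brauer m n) (sandwich m n \<sigma>) \<inter> D_set m n \<sigma> q)) = t q)"
proof -
  let ?U = "range Unprimed" and ?V = "vertices m n"
  let ?E = "idempotents (brauer m n) (sandwich m n \<sigma>)"
  define t where "t = (\<lambda>q::nat. real (r choose q) *
               (real_of_int (odd_dfact (int r - int q - 1))
                * real_of_int (odd_dfact (int m + int q - 1))
                * real_of_int (odd_dfact (int n + int q - 1)))
             / (real_of_int (odd_dfact (int r + int q - 1))
                * real_of_int (odd_dfact (2 * int q - 1))))"
  obtain s where s: "s \<in> matchings (vertices n m)" and \<sigma>: "\<sigma> = blocks (vertices n m) s"
    using assms(2) unfolding brauer_eq_blocks by auto
  define g where "g = (\<lambda>v. flip (s (flip v)))"
  have finV: "finite ?V" by (simp add: vertices_def)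
  have r: "card (crossing ?U g) = r"
    using brauer_rank_blocks[OF s] card_crossing_reflected[OF s g_def] assms(3) \<sigma> by simp
  have gM: "g \<in> matchings ?V" using g_in_matchings[OF s g_def] .
  have "?V \<inter> ?U = Unprimed ` {1..m}" "?V - ?U = Primed ` {1..n}" by (auto simp: vertices_def)
  then have cV: "card (?V \<inter> ?U) = m" "card (?V - ?U) = n" by (auto simp: card_image inj_on_def)
  have nr: "even (n + r)" using even_card_outside[OF gM finV, of ?U] r cV by simp
  have mn: "even m \<longleftrightarrow> even n" using assms(1) by (simp add: cong_def even_iff_mod_2_eq_zero)
  have bij: "bij_betw (blocks ?V) (sep_matchings ?V ?U g q) {\<alpha> \<in> ?E. brauer_rank \<alpha> = q}" for q
  proof -
    have "{\<alpha> \<in> ?E. brauer_rank \<alpha> = q} = blocks ?V ` sep_matchings ?V ?U g q"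
    proof (intro equalityI subsetI)
      fix \<alpha> assume \<alpha>: "\<alpha> \<in> {\<alpha> \<in> ?E. brauer_rank \<alpha> = q}"
      then obtain f where f: "f \<in> matchings ?V" "\<alpha> = blocks ?V f"
        using brauer_eq_blocks[of m n] by (auto simp: idempotents_def)
      then have "f \<in> sep_matchings ?V ?U g q"
        using \<alpha> sandwich_idempotent_iff[OF f(1) s g_def] brauer_rank_blocks[OF f(1)] \<sigma>
        by (simp add: idempotents_def sep_matchings_def)
      with f show "\<alpha> \<in> blocks ?V ` sep_matchings ?V ?U g q" by auto
    next
      fix \<alpha> assume "\<alpha> \<in> blocks ?V ` sep_matchings ?V ?U g q"
      then obtain f where f: "f \<in> sep_matchings ?V ?U g q" "\<alpha> = blocks ?V f" by auto
      then have fM: "f \<in> matchings ?V" by (simp add: sep_matchings_def)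
      have "\<alpha> \<in> brauer m n" using brauer_eq_blocks[of m n] fM f by auto
      then show "\<alpha> \<in> {\<alpha> \<in> ?E. brauer_rank \<alpha> = q}"
        using f sandwich_idempotent_iff[OF fM s g_def] brauer_rank_blocks[OF fM] \<sigma>
        by (simp add: idempotents_def sep_matchings_def)
    qed
    then show ?thesis
      by (intro bij_betw_subset[OF bij_betw_blocks_brauer]) (auto simp: sep_matchings_def)
  qed
  have count: "real (card {\<alpha> \<in> ?E. brauer_rank \<alpha> = q}) = t q" if q: "q \<le> r" "even (r + q)" for q
  proof -
    have e: "even (m + q)" "even (n + q)" "even (r - q)" using q nr mn by auto
    let ?d = dfact_odd
    have "card (sep_matchings ?V ?U g q) * (?d ((r + q) div 2) * ?d q) =
        (r choose q) * (?d ((r - q) div 2) * ?d ((n + q) div 2) * ?d ((m + q) div 2))"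
      using card_sep_matchings[OF finV gM r q(2)] cV by simp
    then have "real (card (sep_matchings ?V ?U g q)) * (real (?d ((r + q) div 2)) * real (?d q)) =
        real (r choose q) * (real (?d ((r - q) div 2)) * real (?d ((n + q) div 2)) * real (?d ((m + q) div 2)))"
      by (metis of_nat_mult)
    moreover have "real (?d ((r + q) div 2)) * real (?d q) \<noteq> 0"
      using dfact_odd_pos by (metis less_irrefl mult_eq_0_iff of_nat_eq_0_iff)
    ultimately have "real (card (sep_matchings ?V ?U g q)) =
        real (r choose q) * (real (?d ((r - q) div 2)) * real (?d ((m + q) div 2)) * real (?d ((n + q) div 2)))
          / (real (?d ((r + q) div 2)) * real (?d q))"
      by (simp add: eq_divide_eq mult_ac)
    moreover have "odd_dfact (int r - int q - 1) = int (?d ((r - q) div 2))"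
      "odd_dfact (int m + int q - 1) = int (?d ((m + q) div 2))"
      "odd_dfact (int n + int q - 1) = int (?d ((n + q) div 2))"
      "odd_dfact (int r + int q - 1) = int (?d ((r + q) div 2))"
      using e q by (auto intro!: odd_dfact_pred_even)
    moreover have "odd_dfact (2 * int q - 1) = int (?d q)" by (simp add: odd_dfact_eq)
    ultimately show ?thesis using bij_betw_same_card[OF bij[of q]] by (simp add: t_def)
  qed
  \<comment> \<open>The counting formula contains the factor \<open>r choose q\<close>, so idempotents have rank at most \<open>r\<close>.\<close>
  have rank_range: "brauer_rank \<alpha> \<le> r \<and> even (r + brauer_rank \<alpha>)" if "\<alpha> \<in> ?E" for \<alpha>
  proof -
    let ?q = "brauer_rank \<alpha>" 
    have "\<alpha> \<in> blocks ?V ` sep_matchings ?V ?U g ?q"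
      using that bij_betw_imp_surj_on[OF bij[of ?q]] by simp
    then obtain f where f: "f \<in> sep_matchings ?V ?U g ?q" by auto
    then have "even (n + ?q)"
      using even_card_outside[of f ?V ?U] finV cV by (auto simp: sep_matchings_def)
    then have ev: "even (r + ?q)" using nr by auto
    have "card (sep_matchings ?V ?U g ?q) > 0"
      using f finite_sep_matchings[OF finV] by (auto simp: card_gt_0_iff)
    then have "(r choose ?q) \<noteq> 0"
      using card_sep_matchings[OF finV gM r ev] dfact_odd_pos
      by (metis mult_eq_0_iff mult_is_0 less_irrefl)
    with ev show ?thesis by (metis binomial_eq_0 not_le)
  qed
  have par: "[q = r] (mod 2) \<longleftrightarrow> even (r + q)" for q
    unfolding cong_def by presburger
  let ?Q = "{q \<in> {0..r}. [q = r] (mod 2)}"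
  have E: "?E = (\<Union>q\<in>?Q. {\<alpha> \<in> ?E. brauer_rank \<alpha> = q})" using rank_range par by auto
  have finE: "finite {\<alpha> \<in> ?E. brauer_rank \<alpha> = q}" for q
    using bij_betw_finite[OF bij[of q]] finite_sep_matchings[OF finV] by blast
  have "card ?E = (\<Sum>q\<in>?Q. card {\<alpha> \<in> ?E. brauer_rank \<alpha> = q})"
    by (subst E, rule card_UN_disjoint) (use finE in auto)
  then have "real (card ?E) = (\<Sum>q\<in>?Q. t q)" using count par by simp
  moreover have "?E \<inter> D_set m n \<sigma> q = {\<alpha> \<in> ?E. brauer_rank \<alpha> = q}" for q
    using idempotents_subset_regulars by (fastforce simp: D_set_def)
  then have "real (card (?E \<inter> D_set m n \<sigma> q)) = t q" if "q \<in> {0..r}" "[q = r] (mod 2)" for q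
    using count[of q] par that by simp
  ultimately show ?thesis unfolding Let_def t_def by blast
qed

end
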